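(* For every $n\ge 0$ and each of the ten pairs $(\tau,\mathsf{stat})$ listed below, $$C_n(t,q)=\sum_{\pi\in\mathfrak{S}_n(\tau)}t^{\mathsf{des}\,\pi}q^{\mathsf{stat}\,\pi}.$$ The ten pairs are: (1) $(231,\ 13\text{-}2)$; (2) $(231,\ \mathsf{adi}^* )$; (3) $(312,\ 2\text{-}13)$; (4) $(312,\ \mathsf{adi})$; (5) $(213,\ 31\text{-}2)$; (6) $(132,\ 2\text{-}31)$; (7) $(231,\ 31\text{-}2)$; (8) $(312,\ 2\text{-}31)$; (9) $(213,\ 13\text{-}2)$; (10) $(132,\ 2\text{-}13)$.
   Context: The $(q,t)$-Catalan numbers $C_n(t,q)$ are defined as the Taylor coefficients of the continued fraction $$\sum_{n\ge0}C_n(t,q)z^n=\cfrac{1}{1-\cfrac{c_1z}{1-\cfrac{c_2z}{1-\cfrac{c_3z}{\ddots}}}},\qquad c_{2k-1}=q^{k-1},\ c_{2k}=tq^{k-1}\ (k\ge1).$$ $\mathfrak{S}_n$ is the set of permutations of $[n]$; $\mathfrak{S}_n(\tau)$ is the set of $\pi\in\mathfrak{S}_n$ avoiding the classical pattern $\tau$ (no subsequence order-isomorphic to $\tau$). $\mathsf{des}\,\pi=\#\{i\in[n-1]:\pi(i)>\pi(i+1)\}$. Vincular pattern counts: $(31\text{-}2)\pi=\#\{(i,j): i+1<j\le n,\ \pi(i+1)<\pi(j)<\pi(i)\}$; $(2\text{-}31)\pi=\#\{(i,j): j<i<n,\ \pi(i+1)<\pi(j)<\pi(i)\}$; $(2\text{-}13)\pi=\#\{(i,j):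 j<i<n,\ \pi(i)<\pi(j)<\pi(i+1)\}$; $(13\text{-}2)\pi=\#\{(i,j): i+1<j\le n,\ \pi(i)<\pi(j)<\pi(i+1)\}$. Admissible inversions: set $\pi(n+1)=0$; an inversion pair $(\pi(i),\pi(j))$ (i.e. $1\le i<j\le n$, $\pi(i)>\pi(j)$) is admissible if $\pi(j)<\pi(j+1)$ or there is $l$ with $i<l<j$ and $\pi(l)<\pi(j)$; $\mathsf{adi}\,\pi$ is the number of admissible inversions. Star admissible inversions: set $\pi(0)=n+1$; an inversion pair $(\pi(i),\pi(j))$ with $i<j$ is star admissible if $\pi(i-1)<\pi(i)$ or there is $l$ with $i<l<j$ and $\pi(l)>\pi(i)$; $\mathsf{adi}^*\,\pi$ is their number. *)

theory Defs
  imports "HOL-Computational_Algebra.Formal_Power_Series" "HOL-Combinatorics.Permutations"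
begin

text \<open>Coefficients of the continued fraction: c_(2k-1) = q^(k-1), c_(2k) = t q^(k-1), k >= 1.
  For index j >= 1 this is: odd j gives q^((j-1) div 2), even j gives t q^((j-1) div 2).\<close>
definition qtcf_coeff :: "'a::field \<Rightarrow> 'a \<Rightarrow> nat \<Rightarrow> 'a" where
  "qtcf_coeff t q j = (if odd j then q ^ ((j - 1) div 2) else t * q ^ ((j - 1) div 2))"

fun cf_tail :: "(nat \<Rightarrow> 'a::field) \<Rightarrow> nat \<Rightarrow> nat \<Rightarrow> 'a fps" where
  "cf_tail c 0 j = 1"
| "cf_tail c (Suc m) j = inverse (1 - fps_const (c j) * fps_X * cf_tail c m (Suc j))"

definition cont_frac :: "(nat \<Rightarrow> 'a::field) \<Rightarrow> 'a fps" where
  "cont_frac c = lim (\<lambda>m. cf_tail c m 1)"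

definition qt_catalan :: "nat \<Rightarrow> 'a::field \<Rightarrow> 'a \<Rightarrow> 'a" where
  "qt_catalan n t q = fps_nth (cont_frac (qtcf_coeff t q)) n"

definition perms :: "nat \<Rightarrow> (nat \<Rightarrow> nat) set" where
  "perms n = {\<pi>. \<pi> permutes {1..n}}"

definition contains :: "nat \<Rightarrow> (nat \<Rightarrow> nat) \<Rightarrow> nat list \<Rightarrow> bool" where
  "contains n \<pi> \<tau> \<longleftrightarrow> (\<exists>pos :: nat \<Rightarrow> nat.
      (\<forall>a < length \<tau>. 1 \<le> pos a \<and> pos a \<le> n) \<and>
      (\<forall>a b. a < b \<and> b < length \<tau> \<longrightarrow> pos a < pos b) \<and>
      (\<forall>a < length \<tau>. \<forall>b < length \<tau>. \<pi> (pos a) < \<pi> (pos b) \<longleftrightarrow> \<tau> ! a < \<tau> ! b))"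

definition avoiding :: "nat \<Rightarrow> nat list \<Rightarrow> (nat \<Rightarrow> nat) set" where
  "avoiding n \<tau> = {\<pi> \<in> perms n. \<not> contains n \<pi> \<tau>}"

definition des :: "nat \<Rightarrow> (nat \<Rightarrow> nat) \<Rightarrow> nat" where
  "des n \<pi> = card {i. 1 \<le> i \<and> i \<le> n - 1 \<and> \<pi> i > \<pi> (Suc i)}"

definition pat_31_2 :: "nat \<Rightarrow> (nat \<Rightarrow> nat) \<Rightarrow> nat" where
  "pat_31_2 n \<pi> = card {(i, j). 1 \<le> i \<and> i + 1 < j \<and> j \<le> n \<and> \<pi> (i+1) < \<pi> j \<and> \<pi> j < \<pi> i}"

definition pat_2_31 :: "nat \<Rightarrow> (nat \<Rightarrow> nat) \<Rightarrow> nat" where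
  "pat_2_31 n \<pi> = card {(i, j). 1 \<le> j \<and> j < i \<and> i < n \<and> \<pi> (i+1) < \<pi> j \<and> \<pi> j < \<pi> i}"

definition pat_2_13 :: "nat \<Rightarrow> (nat \<Rightarrow> nat) \<Rightarrow> nat" where
  "pat_2_13 n \<pi> = card {(i, j). 1 \<le> j \<and> j < i \<and> i < n \<and> \<pi> i < \<pi> j \<and> \<pi> j < \<pi> (i+1)}"

definition pat_13_2 :: "nat \<Rightarrow> (nat \<Rightarrow> nat) \<Rightarrow> nat" where
  "pat_13_2 n \<pi> = card {(i, j). 1 \<le> i \<and> i + 1 < j \<and> j \<le> n \<and> \<pi> i < \<pi> j \<and> \<pi> j < \<pi> (i+1)}"

definition adi :: "nat \<Rightarrow> (nat \<Rightarrow> nat) \<Rightarrow> nat" where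
  "adi n \<pi> = (let \<pi>' = \<pi>(n+1 := 0) in
     card {(i, j). 1 \<le> i \<and> i < j \<and> j \<le> n \<and> \<pi> i > \<pi> j \<and>
        (\<pi> j < \<pi>' (j+1) \<or> (\<exists>l. i < l \<and> l < j \<and> \<pi> l < \<pi> j))})"

definition adi_star :: "nat \<Rightarrow> (nat \<Rightarrow> nat) \<Rightarrow> nat" where
  "adi_star n \<pi> = (let \<pi>' = \<pi>(0 := n+1) in
     card {(i, j). 1 \<le> i \<and> i < j \<and> j \<le> n \<and> \<pi> i > \<pi> j \<and>
        (\<pi>' (i-1) < \<pi> i \<or> (\<exists>l. i < l \<and> l < j \<and> \<pi> l > \<pi> i))})"

definition des_stat_gf ::
    "nat \<Rightarrow> nat list \<Rightarrow> (nat \<Rightarrow> (nat \<Rightarrow> nat) \<Rightarrow> nat) \<Rightarrow> 'a::field \<Rightarrow> 'a \<Rightarrow> 'a" where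
  "des_stat_gf n \<tau> stat t q = (\<Sum>\<pi>\<in>avoiding n \<tau>. t ^ des n \<pi> * q ^ stat n \<pi>)"

end

theory Submission
  imports Defs
begin

text \<open>
  The coefficients satisfy \<open>c (j + 2) = q * c j\<close>, so the continued fraction \<open>F(z)\<close> is the solution of
  \<open>F(z) = 1 + z F(z) + t z F(q z) (F(z) - 1)\<close>. Reverse-complement preserves \<open>des\<close> and complement
  exchanges descents and ascents, so all ten sums become sums over 231-avoiders \<open>\<pi>\<close> of \<open>t\<close> to the
  number of descents or ascents times \<open>q\<close> to the power 13-2 or 31-2; on 231-avoiders \<open>adi_star\<close> is
  13-2. A nonempty 231-avoider is \<open>\<sigma> n \<tau>\<close> with all letters of \<open>\<sigma>\<close> below those of \<open>\<tau>\<close>.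
  Inserting \<open>n\<close> creates \<open>length \<tau>\<close> new occurrences of 13-2 (none if \<open>\<sigma>\<close> is empty), which gives
  the functional equation directly. It creates \<open>length \<tau> - first \<tau>\<close> new occurrences of 31-2 (letters
  of \<open>\<tau>\<close> being renumbered from 1); here the sums weighted by the additional factor
  \<open>q ^ (n - \<pi> 1)\<close> satisfy an equation of their own, and eliminating them gives the same
  equation for \<open>F\<close>.
\<close>

unbundle fps_syntax

subsection \<open>Continued fractions\<close>

text \<open>Both sides satisfy equations of the same shape, so their difference is a multiple of
  \<open>?u - ?v\<close>. The factor \<open>fps_X\<close> in \<open>?u\<close> and \<open>?v\<close>
  gains one order of agreement per level, so truncation depth \<open>m\<close> settles the
  coefficients up to \<open>m\<close>.\<close>

lemma cf_tail_nth_eq: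
  fixes c :: "nat \<Rightarrow> 'a::field"
  assumes G: "\<And>j. j \<ge> 1 \<Longrightarrow> G j * (1 - fps_const (c j) * fps_X * G (Suc j)) = 1"
    and "n \<le> m" and "j \<ge> 1"
  shows "cf_tail c m j $ n = G j $ n"
  using \<open>n \<le> m\<close> \<open>j \<ge> 1\<close>
proof (induction m arbitrary: j n)
  case 0
  have "G j $ 0 = 1"
    using arg_cong[OF G[OF \<open>j \<ge> 1\<close>], of "\<lambda>f. f $ 0"] by simp
  then show ?case using 0 by simp
next
  case (Suc m)
  let ?u = "fps_const (c j) * fps_X * G (Suc j)"
  let ?v = "fps_const (c j) * fps_X * cf_tail c m (Suc j)"
  have nz: "(1 - ?u) $ 0 \<noteq> 0" "(1 - ?v) $ 0 \<noteq> 0" by simp_all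
  have uv: "?u $ i = ?v $ i" if "i \<le> Suc m" for i
    using that Suc.IH[of "i - 1" "Suc j"] by (cases i) (simp_all add: mult.assoc)
  have "G j - cf_tail c (Suc m) j = G j * cf_tail c (Suc m) j * (?u - ?v)"
  proof -
    have "G j * (1 - ?u) = 1" using Suc.prems(2) by (rule G)
    moreover have "cf_tail c (Suc m) j * (1 - ?v) = 1"
      using inverse_mult_eq_1[OF nz(2)] by simp
    ultimately show ?thesis by algebra
  qed
  moreover have "(G j * cf_tail c (Suc m) j * (?u - ?v)) $ n = 0"
    unfolding fps_mult_nth[of "G j * cf_tail c (Suc m) j"]
    using Suc.prems uv by (intro sum.neutral ballI) simp
  ultimately show ?case
    by (metis fps_sub_nth right_minus_eq)
qed

text \<open>The tails \<open>G j\<close> can thus be guessed and verified instead of computed.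
  Convergence of power series means that each coefficient eventually agrees with that of the
  limit.\<close>

lemma cont_frac_eq:
  fixes c :: "nat \<Rightarrow> 'a::field"
  assumes "\<And>j. j \<ge> 1 \<Longrightarrow> G j * (1 - fps_const (c j) * fps_X * G (Suc j)) = 1"
  shows "cont_frac c = G 1"
proof -
  have "(\<lambda>m. cf_tail c m 1) \<longlonglongrightarrow> G 1"
    unfolding tendsto_fps_iff
  proof
    fix n
    show "\<forall>\<^sub>F m in sequentially. cf_tail c m 1 $ n = G 1 $ n"
      using eventually_ge_at_top[of n] 
      by eventually_elim (rule cf_tail_nth_eq[where G = G], simp_all add: assms)
  qed
  then show ?thesis unfolding cont_frac_def by (rule limI)
qed

section \<open>The substitution \<open>z -> q z\<close> and the functional equation\<close>

definition fps_scale :: "'a::field \<Rightarrow> 'a fps \<Rightarrow> 'a fps" where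
  "fps_scale q f = f oo (fps_const q * fps_X)"

lemma fps_scale_nth [simp]: "fps_scale q f $ n = q ^ n * f $ n"
  by (simp add: fps_scale_def fps_compose_linear)

lemma fps_scale_simps [simp]:
  "fps_scale q (f + g) = fps_scale q f + fps_scale q g"
  "fps_scale q (f - g) = fps_scale q f - fps_scale q g"
  "fps_scale q (f * g) = fps_scale q f * fps_scale q g"
  "fps_scale q 1 = 1"
  "fps_scale q (fps_const a) = fps_const a"
  "fps_scale q fps_X = fps_const q * fps_X"
  by (simp_all add: fps_scale_def fps_compose_add_distrib fps_compose_sub_distrib
      fps_compose_mult_distrib)

lemma fps_scale_one [simp]: "fps_scale 1 f = f"
  by (simp add: fps_eq_iff)

lemma fps_scale_scale [simp]: "fps_scale p (fps_scale q f) = fps_scale (p * q) f"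
  by (simp add: fps_eq_iff power_mult_distrib mult.assoc)

text \<open>With \<open>E\<close> for the tail starting at the second coefficient, the equation
  splits into \<open>F = 1 / (1 - z E)\<close> and \<open>E = 1 / (1 - t z F(q z))\<close>. Going
  two levels down multiplies every coefficient by \<open>q\<close>, which amounts to replacing
  \<open>z\<close> by \<open>q z\<close>, so the tails are alternately \<open>F(q^k z)\<close> and
  \<open>E(q^k z)\<close>.\<close>

lemma qt_catalan_unique:
  fixes t q :: "'a::field"
  assumes F: "F = 1 + fps_X * F + fps_const t * fps_X * fps_scale q F * (F - 1)"
  shows "qt_catalan n t q = F $ n"
proof -
  define E where "E = inverse (1 - fps_const t * fps_X * fps_scale q F)"
  have E: "E * (1 - fps_const t * fps_X * fps_scale q F) = 1"
    unfolding E_def by (rule inverse_mult_eq_1) simp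
  \<comment> \<open>Multiplying by the inverse of \<open>E\<close> clears \<open>E\<close> and
    leaves the functional equation.\<close>
  have FE: "F * (1 - fps_X * E) = 1"
  proof -
    let ?d = "1 - fps_const t * fps_X * fps_scale q F"
    have "?d * (F * (1 - fps_X * E)) = ?d * 1"
      using E F by algebra
    moreover have "?d \<noteq> 0" using E by auto
    ultimately show ?thesis by (metis mult_left_cancel)
  qed
  \<comment> \<open>Levels count from 1, so \<open>2 * k + 1\<close> and \<open>2 * k + 2\<close>
    share the scaling \<open>q ^ k\<close>.\<close>
  define G where "G j = fps_scale (q ^ ((j - 1) div 2)) (if odd j then F else E)" for j
  have step: "G (Suc j) * (1 - fps_const (qtcf_coeff t q (Suc j)) * fps_X * G (Suc (Suc j))) = 1" for j
  proof (cases "even j")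
    case True
    then obtain k where "j = 2 * k" by blast
    then show ?thesis
      using arg_cong[OF FE, of "fps_scale (q ^ k)"]
      by (simp add: G_def qtcf_coeff_def)
  next
    case False
    then obtain k where "j = 2 * k + 1" using oddE by blast
    then show ?thesis
      using arg_cong[OF E, of "fps_scale (q ^ k)"]
      by (simp add: G_def qtcf_coeff_def mult_ac flip: fps_const_mult)
  qed
  have "cont_frac (qtcf_coeff t q) = G 1"
    by (rule cont_frac_eq) (metis step Suc_le_D One_nat_def)
  then show ?thesis by (simp add: qt_catalan_def G_def)
qed

subsection \<open>Decomposition of 231-avoiding permutations at the maximum\<close>

lemma contains_3:
  "contains n \<pi> [a, b, c] \<longleftrightarrow>
    (\<exists>i j k. 1 \<le> i \<and> i < j \<and> j < k \<and> k \<le> n \<and>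
      (\<pi> i < \<pi> j \<longleftrightarrow> a < b) \<and> (\<pi> j < \<pi> i \<longleftrightarrow> b < a) \<and>
      (\<pi> i < \<pi> k \<longleftrightarrow> a < c) \<and> (\<pi> k < \<pi> i \<longleftrightarrow> c < a) \<and>
      (\<pi> j < \<pi> k \<longleftrightarrow> b < c) \<and> (\<pi> k < \<pi> j \<longleftrightarrow> c < b))"
  (is "?L \<longleftrightarrow> ?R")
proof
  assume ?L
  then obtain pos :: "nat \<Rightarrow> nat" where
    pos: "\<forall>x < 3. 1 \<le> pos x \<and> pos x \<le> n" "\<forall>x y. x < y \<and> y < 3 \<longrightarrow> pos x < pos y"
      "\<forall>x < 3. \<forall>y < 3. \<pi> (pos x) < \<pi> (pos y) \<longleftrightarrow> [a, b, c] ! x < [a, b, c] ! y"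
    unfolding contains_def by (auto simp: numeral_3_eq_3)
  show ?R
    using pos(1)[rule_format, of 0] pos(1)[rule_format, of 2]
      pos(2)[rule_format, of 0 1] pos(2)[rule_format, of 1 2]
      pos(3)[rule_format, of 0 1] pos(3)[rule_format, of 1 0]
      pos(3)[rule_format, of 0 2] pos(3)[rule_format, of 2 0]
      pos(3)[rule_format, of 1 2] pos(3)[rule_format, of 2 1]
    by (intro exI[of _ "pos 0"] exI[of _ "pos 1"] exI[of _ "pos 2"]) simp
next
  assume ?R
  then obtain i j k where "1 \<le> i" "i < j" "j < k" "k \<le> n"
      "\<pi> i < \<pi> j \<longleftrightarrow> a < b" "\<pi> j < \<pi> i \<longleftrightarrow> b < a"
      "\<pi> i < \<pi> k \<longleftrightarrow> a < c" "\<pi> k < \<pi> i \<longleftrightarrow> c < a"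
      "\<pi> j < \<pi> k \<longleftrightarrow> b < c" "\<pi> k < \<pi> j \<longleftrightarrow> c < b"
    by blast
  then show ?L
    unfolding contains_def
    by (intro exI[of _ "\<lambda>x. [i, j, k] ! x"]) (auto simp: less_Suc_eq numeral_2_eq_2)
qed

lemma contains_231:
  "contains n \<pi> [2, 3, 1] \<longleftrightarrow>
    (\<exists>i j k. 1 \<le> i \<and> i < j \<and> j < k \<and> k \<le> n \<and> \<pi> k < \<pi> i \<and> \<pi> i < \<pi> j)"
  unfolding contains_3 by (intro ex_cong1) auto

lemma contains_213:
  "contains n \<pi> [2, 1, 3] \<longleftrightarrow>
    (\<exists>i j k. 1 \<le> i \<and> i < j \<and> j < k \<and> k \<le> n \<and> \<pi> j < \<pi> i \<and> \<pi> i < \<pi> k)"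
  unfolding contains_3 by (intro ex_cong1) auto

lemma contains_312:
  "contains n \<pi> [3, 1, 2] \<longleftrightarrow>
    (\<exists>i j k. 1 \<le> i \<and> i < j \<and> j < k \<and> k \<le> n \<and> \<pi> j < \<pi> k \<and> \<pi> k < \<pi> i)"
  unfolding contains_3 by (intro ex_cong1) auto

lemma contains_132:
  "contains n \<pi> [1, 3, 2] \<longleftrightarrow>
    (\<exists>i j k. 1 \<le> i \<and> i < j \<and> j < k \<and> k \<le> n \<and> \<pi> i < \<pi> k \<and> \<pi> k < \<pi> j)"
  unfolding contains_3 by (intro ex_cong1) auto

section \<open>Permutations as functions fixing everything outside \<open>{1..n}\<close>\<close>

lemma permsI:
  assumes "\<And>i. 1 \<le> i \<Longrightarrow> i \<le> n \<Longrightarrow> 1 \<le> \<pi> i \<and> \<pi> i \<le> n"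
    and "\<And>i j. 1 \<le> i \<Longrightarrow> i < j \<Longrightarrow> j \<le> n \<Longrightarrow> \<pi> i \<noteq> \<pi> j"
    and "\<And>i. i = 0 \<or> n < i \<Longrightarrow> \<pi> i = i"
  shows "\<pi> \<in> perms n"
proof -
  have "inj_on \<pi> {1..n}"
    using assms(2) by (auto intro: linorder_inj_onI)
  moreover have "\<pi> ` {1..n} \<subseteq> {1..n}"
    using assms(1) by auto
  ultimately have "bij_betw \<pi> {1..n} {1..n}"
    by (simp add: bij_betw_def endo_inj_surj)
  then show ?thesis
    unfolding perms_def using assms(3) by (auto intro!: bij_imp_permutes simp: not_le)
qed

lemma perms_range: "\<pi> \<in> perms n \<Longrightarrow> 1 \<le> i \<Longrightarrow> i \<le> n \<Longrightarrow> 1 \<le> \<pi> i \<and> \<pi> i \<le> n"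
  unfolding perms_def using permutes_in_image[of \<pi> "{1..n}" i] by auto

lemma perms_outside: "\<pi> \<in> perms n \<Longrightarrow> i = 0 \<or> n < i \<Longrightarrow> \<pi> i = i"
  unfolding perms_def by (auto intro: permutes_not_in)

lemma perms_eq_iff: "\<pi> \<in> perms n \<Longrightarrow> \<pi> i = \<pi> j \<longleftrightarrow> i = j"
  unfolding perms_def by (auto dest: permutes_inj injD)

lemma finite_avoiding [simp]: "finite (avoiding n p)"
  unfolding avoiding_def perms_def by (simp add: finite_permutations)

text \<open>The one-line word of \<sigma>, then the new maximum, then \<tau> raised by
  \<open>k\<close>. Positions beyond the word are fixed and position 0 inherits
  \<open>\<sigma> 0\<close>, which is 0 for a permutation, as \<open>permutes\<close>
  requires.\<close>

definition join :: "nat \<Rightarrow> nat \<Rightarrow> (nat \<Rightarrow> nat) \<Rightarrow> (nat \<Rightarrow> nat) \<Rightarrow> nat \<Rightarrow> nat" where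
  "join k m \<sigma> \<tau> i =
    (if i \<le> k then \<sigma> i else if i = Suc k then Suc (k + m)
     else if i \<le> Suc (k + m) then k + \<tau> (i - Suc k) else i)"

lemma join_left: "i \<le> k \<Longrightarrow> join k m \<sigma> \<tau> i = \<sigma> i"
  and join_mid: "join k m \<sigma> \<tau> (Suc k) = Suc (k + m)"
  and join_right: "1 \<le> i \<Longrightarrow> i \<le> m \<Longrightarrow> join k m \<sigma> \<tau> (Suc (k + i)) = k + \<tau> i"
  by (simp_all add: join_def)

lemma position_cases:
  assumes "1 \<le> (i::nat)" "i \<le> Suc (k + m)"
  obtains (left) "i \<le> k" | (mid) "i = Suc k"
    | (right) i' where "1 \<le> i'" "i' \<le> m" "i = Suc (k + i')"
proof -
  have "i = Suc (k + (i - Suc k))" if "Suc k < i" using that by simp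
  with assms show thesis
    by (metis that Suc_lessI le_add_diff_inverse nat_add_left_cancel_le not_less
        diff_is_0_eq less_one not_less_eq_eq Suc_le_mono linorder_neqE_nat less_Suc_eq_le)
qed

lemma join_perms:
  assumes "\<sigma> \<in> perms k" "\<tau> \<in> perms m"
  shows "join k m \<sigma> \<tau> \<in> perms (Suc (k + m))"
proof (rule permsI)
  fix i assume i: "1 \<le> i" "i \<le> Suc (k + m)"
  then show "1 \<le> join k m \<sigma> \<tau> i \<and> join k m \<sigma> \<tau> i \<le> Suc (k + m)"
  proof (cases rule: position_cases)
    case left
    then show ?thesis using perms_range[OF assms(1) i(1)] by (simp add: join_left)
  next
    case mid
    then show ?thesis by (simp add: join_mid)
  next
    case (right i')
    then show ?thesis using perms_range[OF assms(2), of i'] by (simp add: join_right)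
  qed
next
  fix i j assume ij: "1 \<le> i" "i < j" "j \<le> Suc (k + m)"
  have i: "1 \<le> i" "i \<le> Suc (k + m)" and j: "1 \<le> j" "j \<le> Suc (k + m)"
    using ij by auto
  show "join k m \<sigma> \<tau> i \<noteq> join k m \<sigma> \<tau> j"
    using i
  proof (cases rule: position_cases)
    case i_left: left
    note i_bound = perms_range[OF assms(1) i(1) i_left]
    show ?thesis
      using j
    proof (cases rule: position_cases)
      case left
      then show ?thesis using i_left ij by (simp add: join_left perms_eq_iff[OF assms(1)])
    next
      case mid
      then show ?thesis using i_left i_bound by (simp add: join_left join_mid)
    next
      case (right j')
      then show ?thesis
        using i_left i_bound perms_range[OF assms(2), of j'] by (simp add: join_left join_right)
    qed
  next
    case mid
    obtain j' where "1 \<le> j'" "j' \<le> m" "j = Suc (k + j')"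
      using j ij mid by (cases rule: position_cases) auto
    then show ?thesis
      using mid perms_range[OF assms(2), of j'] by (simp add: join_mid join_right)
  next
    case (right i')
    obtain j' where "1 \<le> j'" "j' \<le> m" "j = Suc (k + j')"
      using j ij right by (cases rule: position_cases) auto
    then show ?thesis
      using right ij by (simp add: join_right perms_eq_iff[OF assms(2)])
  qed
next
  fix i :: nat assume "i = 0 \<or> Suc (k + m) < i"
  then show "join k m \<sigma> \<tau> i = i"
    using perms_outside[OF assms(1)] by (auto simp: join_def)
qed

text \<open>The last letter of a 231 is its smallest. If the first letter lies in \<sigma>, the last
  must too, since everything after \<sigma> is larger, and the whole pattern sits in \<sigma>. The
  maximum cannot be the first letter, and a pattern starting in \<tau> stays in \<tau>.\<close>

lemma join_avoiding:
  assumes "\<sigma> \<in> avoiding k [2, 3, 1]" "\<tau> \<in> avoiding m [2, 3, 1]"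
  shows "join k m \<sigma> \<tau> \<in> avoiding (Suc (k + m)) [2, 3, 1]"
proof -
  have p: "\<sigma> \<in> perms k" "\<tau> \<in> perms m"
    and av: "\<not> contains k \<sigma> [2, 3, 1]" "\<not> contains m \<tau> [2, 3, 1]"
    using assms by (auto simp: avoiding_def)
  have False if h: "1 \<le> a" "a < b" "b < c" "c \<le> Suc (k + m)"
    "join k m \<sigma> \<tau> c < join k m \<sigma> \<tau> a" "join k m \<sigma> \<tau> a < join k m \<sigma> \<tau> b" for a b c
  proof -
    have a: "1 \<le> a" "a \<le> Suc (k + m)" and b: "1 \<le> b" "b \<le> Suc (k + m)"
      and c: "1 \<le> c" "c \<le> Suc (k + m)"
      using h by auto
    from a show False
    proof (cases rule: position_cases)
      case left
      have "c \<le> k"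
        using c
      proof (cases rule: position_cases)
        case mid
        then show ?thesis
          using h left perms_range[OF p(1) a(1) left] by (simp add: join_left join_mid)
      next
        case (right c')
        then show ?thesis
          using h left perms_range[OF p(1) a(1) left] by (simp add: join_left join_right)
      qed
      then have "1 \<le> a \<and> a < b \<and> b < c \<and> c \<le> k \<and> \<sigma> c < \<sigma> a \<and> \<sigma> a < \<sigma> b"
        using h by (simp add: join_left)
      then show False using av(1) unfolding contains_231 by blast
    next
      case mid
      then show False
        using h perms_range[OF join_perms[OF p] b] by (auto simp: join_mid)
    next
      case (right a')
      obtain b' c' where "b = Suc (k + b')" "c = Suc (k + c')"
        using right h by (metis add_Suc less_iff_Suc_add less_trans add.assoc add_Suc_right)
      then show False
        using av(2) h right unfolding contains_231
        by (auto simp: join_right)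
    qed
  qed
  then show ?thesis
    using join_perms[OF p] unfolding avoiding_def contains_231 by blast
qed

text \<open>The position of the maximum reveals \<open>k\<close>; the two factors can then be read
  off.\<close>

lemma join_inject:
  assumes "\<sigma> \<in> perms k" "\<tau> \<in> perms m" "\<sigma>' \<in> perms k'" "\<tau>' \<in> perms m'"
    and "k + m = k' + m'"
    and eq: "join k m \<sigma> \<tau> = join k' m' \<sigma>' \<tau>'"
  shows "k = k' \<and> \<sigma> = \<sigma>' \<and> \<tau> = \<tau>'"
proof -
  have "join k m \<sigma> \<tau> (Suc k) = join k m \<sigma> \<tau> (Suc k')"
    using join_mid[of k m \<sigma> \<tau>] join_mid[of k' m' \<sigma>' \<tau>'] eq assms(5) by simp
  then have k: "k = k'"
    using perms_eq_iff[OF join_perms[OF assms(1,2)]] by simp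
  then have m: "m = m'" using assms(5) by simp
  have "\<sigma> i = \<sigma>' i" for i
    using fun_cong[OF eq, of i] k perms_outside[OF assms(1), of i] perms_outside[OF assms(3), of i]
    by (cases "i \<le> k") (auto simp: join_left)
  moreover have "\<tau> i = \<tau>' i" for i
    using fun_cong[OF eq, of "Suc (k + i)"] k m
      perms_outside[OF assms(2), of i] perms_outside[OF assms(4), of i]
    by (cases "1 \<le> i \<and> i \<le> m") (auto simp: join_right)
  ultimately show ?thesis using k by auto
qed

text \<open>Avoidance forces every letter before the maximum below every letter after it. Counting
  then shows that the \<open>k\<close> letters before it are exactly the values up to
  \<open>k\<close>.\<close>

lemma avoiding_231_split:
  assumes "\<pi> \<in> avoiding (Suc n) [2, 3, 1]"
  obtains k \<sigma> \<tau> where "k \<le> n" "\<sigma> \<in> avoiding k [2, 3, 1]" "\<tau> \<in> avoiding (n - k) [2, 3, 1]"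
    "\<pi> = join k (n - k) \<sigma> \<tau>"
proof -
  have p: "\<pi> \<in> perms (Suc n)" and av: "\<not> contains (Suc n) \<pi> [2, 3, 1]"
    using assms by (auto simp: avoiding_def)
  have img: "\<pi> ` {1..Suc n} = {1..Suc n}"
    using p unfolding perms_def by (simp add: permutes_image)
  then obtain p0 where p0: "p0 \<in> {1..Suc n}" "\<pi> p0 = Suc n"
    by (metis atLeastAtMost_iff imageE le_refl le_add1 plus_1_eq_Suc)
  define k where "k = p0 - 1"
  define m where "m = n - k"
  have k: "k \<le> n" "\<pi> (Suc k) = Suc n" "n = k + m"
    using p0 by (auto simp: k_def m_def)
  \<comment> \<open>Otherwise \<open>\<pi> i\<close>, the maximum and \<open>\<pi> j\<close> form a
    231.\<close>
  have lt: "\<pi> i < \<pi> j" if "1 \<le> i" "i \<le> k" "Suc k < j" "j \<le> Suc n" for i j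
  proof (rule ccontr)
    assume "\<not> \<pi> i < \<pi> j"
    moreover have "\<pi> i \<noteq> \<pi> j" "\<pi> i \<noteq> \<pi> (Suc k)"
      using that by (auto simp: perms_eq_iff[OF p])
    moreover have "\<pi> i \<le> Suc n"
      using perms_range[OF p, of i] that k by auto
    ultimately have "1 \<le> i \<and> i < Suc k \<and> Suc k < j \<and> j \<le> Suc n \<and> \<pi> j < \<pi> i \<and> \<pi> i < \<pi> (Suc k)"
      using that k by auto
    then show False using av unfolding contains_231 by blast
  qed
  have inj: "inj_on \<pi> A" for A
    using perms_eq_iff[OF p] by (auto intro: inj_onI)
  have left: "\<pi> i \<le> k" if i: "1 \<le> i" "i \<le> k" for i
  proof -
    \<comment> \<open>No value up to \<open>\<pi> i\<close> can be the maximum or, by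
      \<open>lt\<close>, stand to its right, so all of them occupy the first \<open>k\<close>
      positions.\<close>
    have "{1..\<pi> i} \<subseteq> \<pi> ` {1..k}"
    proof
      fix v assume v: "v \<in> {1..\<pi> i}"
      then have "v \<in> {1..Suc n}" using perms_range[OF p, of i] i k by auto
      then obtain j where j: "1 \<le> j" "j \<le> Suc n" "v = \<pi> j" using img by fastforce
      have "\<pi> i < \<pi> (Suc k)"
        using perms_range[OF p, of i] perms_eq_iff[OF p, of i "Suc k"] i k by force
      then have "j \<noteq> Suc k" using j v by auto
      moreover have "\<not> Suc k < j" using lt[OF i, of j] j v by auto
      ultimately show "v \<in> \<pi> ` {1..k}" using j by auto
    qed
    then have "card {1..\<pi> i} \<le> card (\<pi> ` {1..k})" by (intro card_mono) auto
    then show ?thesis by (simp add: card_image[OF inj])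
  qed
  have right: "k < \<pi> j" if j: "Suc k < j" "j \<le> Suc n" for j
  proof -
    \<comment> \<open>Dually, \<open>k\<close> distinct values lie below \<open>\<pi> j\<close>.
      Hence the truncated subtraction in the definition of \<tau> below is exact.\<close>
    have "\<pi> ` {1..k} \<subseteq> {1..<\<pi> j}"
      using lt[OF _ _ j] perms_range[OF p] k by fastforce
    then have "card (\<pi> ` {1..k}) \<le> card {1..<\<pi> j}" by (intro card_mono) auto
    moreover have "1 \<le> \<pi> j" using perms_range[OF p, of j] j by auto
    ultimately show ?thesis by (simp add: card_image[OF inj])
  qed
  define \<sigma> where "\<sigma> i = (if i \<le> k then \<pi> i else i)" for i
  define \<tau> where "\<tau> i = (if 1 \<le> i \<and> i \<le> m then \<pi> (Suc (k + i)) - k else i)" for i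
  have \<tau>: "\<pi> (Suc (k + i)) = k + \<tau> i" if "1 \<le> i" "i \<le> m" for i
    using right[of "Suc (k + i)"] that k by (simp add: \<tau>_def)
  have "\<sigma> \<in> perms k"
  proof (rule permsI)
    show "1 \<le> \<sigma> i \<and> \<sigma> i \<le> k" if "1 \<le> i" "i \<le> k" for i
      using left[OF that] perms_range[OF p, of i] that k by (simp add: \<sigma>_def)
    show "\<sigma> i \<noteq> \<sigma> j" if "1 \<le> i" "i < j" "j \<le> k" for i j
      using that by (simp add: \<sigma>_def perms_eq_iff[OF p])
    show "\<sigma> i = i" if "i = 0 \<or> k < i" for i
      using that perms_outside[OF p, of 0] by (auto simp: \<sigma>_def)
  qed
  moreover have "\<tau> \<in> perms m"
  proof (rule permsI)
    show "1 \<le> \<tau> i \<and> \<tau> i \<le> m" if i: "1 \<le> i" "i \<le> m" for i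
    proof -
      have "\<pi> (Suc (k + i)) \<noteq> \<pi> (Suc k)" using i by (simp add: perms_eq_iff[OF p])
      then show ?thesis
        using \<tau>[OF i] right[of "Suc (k + i)"] perms_range[OF p, of "Suc (k + i)"] i k by auto
    qed
    show "\<tau> i \<noteq> \<tau> j" if ij: "1 \<le> i" "i < j" "j \<le> m" for i j
      using \<tau>[of i] \<tau>[of j] ij perms_eq_iff[OF p, of "Suc (k + i)" "Suc (k + j)"] by auto
    show "\<tau> i = i" if "i = 0 \<or> m < i" for i
      using that by (auto simp: \<tau>_def)
  qed
  moreover have "\<not> contains k \<sigma> [2, 3, 1]"
  proof
    assume "contains k \<sigma> [2, 3, 1]"
    then obtain a b c where "1 \<le> a" "a < b" "b < c" "c \<le> k" "\<sigma> c < \<sigma> a" "\<sigma> a < \<sigma> b"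
      unfolding contains_231 by blast
    then have "1 \<le> a \<and> a < b \<and> b < c \<and> c \<le> Suc n \<and> \<pi> c < \<pi> a \<and> \<pi> a < \<pi> b"
      using k by (simp add: \<sigma>_def)
    then show False using av unfolding contains_231 by blast
  qed
  moreover have "\<not> contains m \<tau> [2, 3, 1]"
  proof
    assume "contains m \<tau> [2, 3, 1]"
    then obtain a b c where "1 \<le> a" "a < b" "b < c" "c \<le> m" "\<tau> c < \<tau> a" "\<tau> a < \<tau> b"
      unfolding contains_231 by blast
    then have "1 \<le> Suc (k + a) \<and> Suc (k + a) < Suc (k + b) \<and> Suc (k + b) < Suc (k + c) \<and>
        Suc (k + c) \<le> Suc n \<and> \<pi> (Suc (k + c)) < \<pi> (Suc (k + a)) \<and>
        \<pi> (Suc (k + a)) < \<pi> (Suc (k + b))"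
      using k \<tau>[of a] \<tau>[of b] \<tau>[of c] by simp
    then show False using av unfolding contains_231 by blast
  qed
  moreover have "\<pi> i = join k m \<sigma> \<tau> i" for i
  proof (cases "1 \<le> i \<and> i \<le> Suc (k + m)")
    case True
    then have i: "1 \<le> i" "i \<le> Suc (k + m)" by auto
    then show ?thesis
      by (cases rule: position_cases) (auto simp: join_left join_mid join_right \<sigma>_def \<tau> k)
  next
    case False
    then show ?thesis
      using perms_outside[OF p, of i] k by (auto simp: join_def \<sigma>_def)
  qed
  ultimately show ?thesis
    using that[of k \<sigma> \<tau>] k unfolding avoiding_def m_def by blast
qed

lemma sum_avoiding_231:
  "(\<Sum>\<pi>\<in>avoiding (Suc n) [2, 3, 1]. f \<pi>) =
    (\<Sum>k=0..n. \<Sum>\<sigma>\<in>avoiding k [2, 3, 1]. \<Sum>\<tau>\<in>avoiding (n - k) [2, 3, 1]. f (join k (n - k) \<sigma> \<tau>))"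
proof -
  define S where "S = (SIGMA k:{0..n}. avoiding k [2, 3, 1] \<times> avoiding (n - k) [2, 3, 1])"
  define J where "J = (\<lambda>(k, \<sigma>, \<tau>). join k (n - k) \<sigma> \<tau>)"
  have "bij_betw J S (avoiding (Suc n) [2, 3, 1])"
    unfolding bij_betw_def
  proof
    show "inj_on J S"
    proof (rule inj_onI)
      fix x y assume xy: "x \<in> S" "y \<in> S" "J x = J y"
      obtain k \<sigma> \<tau> k' \<sigma>' \<tau>' where eqs: "x = (k, \<sigma>, \<tau>)" "y = (k', \<sigma>', \<tau>')"
        by (metis prod_cases3)
      then show "x = y"
        using join_inject[of \<sigma> k \<tau> "n - k" \<sigma>' k' \<tau>' "n - k'"] xy
        by (auto simp: S_def J_def avoiding_def)
    qed
    show "J ` S = avoiding (Suc n) [2, 3, 1]"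
    proof
      show "J ` S \<subseteq> avoiding (Suc n) [2, 3, 1]"
        using join_avoiding[where m = "n - k" and k = k for k] by (fastforce simp: S_def J_def)
      show "avoiding (Suc n) [2, 3, 1] \<subseteq> J ` S"
      proof
        fix \<pi> assume "\<pi> \<in> avoiding (Suc n) [2, 3, 1]"
        then show "\<pi> \<in> J ` S"
          by (rule avoiding_231_split) (force simp: S_def J_def)
      qed
    qed
  qed
  then have "(\<Sum>\<pi>\<in>avoiding (Suc n) [2, 3, 1]. f \<pi>) = (\<Sum>x\<in>S. f (J x))"
    by (rule sum.reindex_bij_betw[symmetric])
  also have "\<dots> = (\<Sum>k=0..n. \<Sum>x\<in>avoiding k [2, 3, 1] \<times> avoiding (n - k) [2, 3, 1].
      f (join k (n - k) (fst x) (snd x)))"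
    unfolding S_def by (subst sum.Sigma) (auto simp: J_def split_def)
  finally show ?thesis
    by (simp add: sum.cartesian_product split_def)
qed

subsection \<open>Statistics of a decomposed permutation\<close>

definition asc :: "nat \<Rightarrow> (nat \<Rightarrow> nat) \<Rightarrow> nat" where
  "asc n \<pi> = card {i. 1 \<le> i \<and> i \<le> n - 1 \<and> \<pi> i < \<pi> (Suc i)}"

text \<open>\<open>P i\<close> is meant as a property of the adjacent positions \<open>i\<close> and
  \<open>Suc i\<close>. Such a pair lies in the left block, lies in the right block, or touches the
  maximum at \<open>Suc k\<close>; the last two summands are the pairs entering and leaving it,
  which exist only if the respective block is nonempty.\<close>

lemma card_adjacent_split:
  "card {i. 1 \<le> i \<and> i \<le> Suc (k + m) - 1 \<and> P i} =
    card {i. 1 \<le> i \<and> i \<le> k - 1 \<and> P i} + card {i. 1 \<le> i \<and> i \<le> m - 1 \<and> P (Suc (k + i))} +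
    (if 0 < k \<and> P k then 1 else 0) + (if 0 < m \<and> P (Suc k) then 1 else 0)"
proof -
  let ?A = "{i. 1 \<le> i \<and> i \<le> k - 1 \<and> P i}" and ?B = "{i. 1 \<le> i \<and> i \<le> m - 1 \<and> P (Suc (k + i))}"
  let ?C = "{i. i = k \<and> 0 < k \<and> P k}" and ?D = "{i. i = Suc k \<and> 0 < m \<and> P (Suc k)}"
  let ?f = "\<lambda>i. Suc (k + i)"
  have fin: "finite ?A" "finite ?B" "finite ?C" "finite ?D" by auto
  have "{i. 1 \<le> i \<and> i \<le> Suc (k + m) - 1 \<and> P i} = ?A \<union> ?f ` ?B \<union> ?C \<union> ?D"
  proof (intro set_eqI iffI)
    fix i assume i: "i \<in> {i. 1 \<le> i \<and> i \<le> Suc (k + m) - 1 \<and> P i}"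
    consider "i < k" | "i = k" | "i = Suc k" | "Suc k < i" by linarith
    then show "i \<in> ?A \<union> ?f ` ?B \<union> ?C \<union> ?D"
    proof cases
      case 4
      then have "i = ?f (i - Suc k)" "i - Suc k \<in> ?B" using i by auto
      then show ?thesis by blast
    qed (use i in auto)
  qed auto
  moreover have "card (?A \<union> ?f ` ?B \<union> ?C \<union> ?D) = card (?A \<union> ?f ` ?B \<union> ?C) + card ?D"
    by (rule card_Un_disjoint) (use fin in auto)
  moreover have "card (?A \<union> ?f ` ?B \<union> ?C) = card (?A \<union> ?f ` ?B) + card ?C"
    by (rule card_Un_disjoint) (use fin in auto)
  moreover have "card (?A \<union> ?f ` ?B) = card ?A + card (?f ` ?B)"
    by (rule card_Un_disjoint) (use fin in auto)
  moreover have "card (?f ` ?B) = card ?B"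
    by (rule card_image) (auto simp: inj_on_def)
  moreover have "card ?C = (if 0 < k \<and> P k then 1 else 0)" by auto
  moreover have "card ?D = (if 0 < m \<and> P (Suc k) then 1 else 0)" by auto
  ultimately show ?thesis by (simp only:)
qed

text \<open>The third set collects the pairs that straddle position \<open>Suc k\<close> or have it
  as an end; only these make a new contribution when two permutations are joined.\<close>

lemma card_pairs_split:
  fixes P :: "nat \<Rightarrow> nat \<Rightarrow> bool"
  shows "card {(i, j). 1 \<le> i \<and> i < j \<and> j \<le> Suc (k + m) \<and> P i j} =
    card {(i, j). 1 \<le> i \<and> i < j \<and> j \<le> k \<and> P i j} +
    card {(i, j). 1 \<le> i \<and> i < j \<and> j \<le> m \<and> P (Suc (k + i)) (Suc (k + j))} +
    card {(i, j). 1 \<le> i \<and> i \<le> Suc k \<and> Suc k \<le> j \<and> i < j \<and> j \<le> Suc (k + m) \<and> P i j}"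
    (is "card ?S = card ?A + card ?B + card ?C")
proof -
  let ?f = "\<lambda>(i, j). (Suc (k + i), Suc (k + j))"
  have "finite ?A" by (rule finite_subset[of _ "{..k} \<times> {..k}"]) auto
  moreover have "finite ?B" by (rule finite_subset[of _ "{..m} \<times> {..m}"]) auto
  moreover have "finite ?C" by (rule finite_subset[of _ "{..Suc k} \<times> {..Suc (k + m)}"]) auto
  ultimately have fin: "finite ?A" "finite ?B" "finite ?C" by blast+
  have "?S = ?A \<union> ?f ` ?B \<union> ?C"
  proof (intro set_eqI iffI)
    fix x assume x: "x \<in> ?S"
    obtain i j where ij: "x = (i, j)" by fastforce
    consider "j \<le> k" | "i \<le> Suc k" "Suc k \<le> j" | "Suc k < i" using x ij by fastforce
    then show "x \<in> ?A \<union> ?f ` ?B \<union> ?C"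
    proof cases
      case 3
      then have "x = ?f (i - Suc k, j - Suc k)" "(i - Suc k, j - Suc k) \<in> ?B" using x ij by auto
      then show ?thesis by blast
    qed (use x ij in auto)
  qed auto
  moreover have "card (?A \<union> ?f ` ?B \<union> ?C) = card (?A \<union> ?f ` ?B) + card ?C"
    by (rule card_Un_disjoint) (use fin in auto)
  moreover have "card (?A \<union> ?f ` ?B) = card ?A + card (?f ` ?B)"
    by (rule card_Un_disjoint) (use fin in auto)
  moreover have "card (?f ` ?B) = card ?B"
    by (rule card_image) (auto simp: inj_on_def)
  ultimately show ?thesis by (simp only:)
qed

context
  fixes k m :: nat and \<sigma> \<tau> :: "nat \<Rightarrow> nat"
  assumes \<sigma>: "\<sigma> \<in> perms k" and \<tau>: "\<tau> \<in> perms m"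
begin

lemma join_right_Suc: "1 \<le> i \<Longrightarrow> i < m \<Longrightarrow> join k m \<sigma> \<tau> (Suc (Suc (k + i))) = k + \<tau> (Suc i)"
  using join_right[of "Suc i" m k] by simp

lemma join_le: "1 \<le> i \<Longrightarrow> i \<le> k \<Longrightarrow> join k m \<sigma> \<tau> i \<le> k"
  using perms_range[OF \<sigma>, of i] by (simp add: join_left)

lemma join_gt: "Suc k < i \<Longrightarrow> i \<le> Suc (k + m) \<Longrightarrow> k < join k m \<sigma> \<tau> i \<and> join k m \<sigma> \<tau> i \<le> k + m"
proof -
  assume "Suc k < i" "i \<le> Suc (k + m)"
  then obtain i' where i': "1 \<le> i'" "i' \<le> m" "i = Suc (k + i')"
    by (intro that[of "i - Suc k"]) auto
  then show ?thesis using perms_range[OF \<tau>, of i'] by (simp add: join_right)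
qed

text \<open>The step into the maximum is an ascent, and the step out of it is a descent, present
  unless \<tau> is empty.\<close>

lemma des_join: "des (Suc (k + m)) (join k m \<sigma> \<tau>) = des k \<sigma> + des m \<tau> + (if m = 0 then 0 else 1)"
proof -
  let ?J = "join k m \<sigma> \<tau>"
  have e1: "{i. 1 \<le> i \<and> i \<le> k - 1 \<and> ?J i > ?J (Suc i)} = {i. 1 \<le> i \<and> i \<le> k - 1 \<and> \<sigma> i > \<sigma> (Suc i)}"
    by (intro Collect_cong) (auto simp: join_left)
  have e2: "{i. 1 \<le> i \<and> i \<le> m - 1 \<and> ?J (Suc (k + i)) > ?J (Suc (Suc (k + i)))} =
      {i. 1 \<le> i \<and> i \<le> m - 1 \<and> \<tau> i > \<tau> (Suc i)}"
    by (intro Collect_cong) (auto simp: join_right join_right_Suc)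
  have e3: "(0 < k \<and> ?J k > ?J (Suc k)) = False"
    using join_le[of k] by (auto simp: join_mid)
  have e4: "(0 < m \<and> ?J (Suc k) > ?J (Suc (Suc k))) = (0 < m)"
    using join_gt[of "Suc (Suc k)"] by (auto simp: join_mid)
  show ?thesis
    unfolding des_def card_adjacent_split[where P = "\<lambda>i. ?J i > ?J (Suc i)"] e1 e2 e3 e4
    by simp
qed

lemma asc_join: "asc (Suc (k + m)) (join k m \<sigma> \<tau>) = asc k \<sigma> + asc m \<tau> + (if k = 0 then 0 else 1)"
proof -
  let ?J = "join k m \<sigma> \<tau>"
  have e1: "{i. 1 \<le> i \<and> i \<le> k - 1 \<and> ?J i < ?J (Suc i)} = {i. 1 \<le> i \<and> i \<le> k - 1 \<and> \<sigma> i < \<sigma> (Suc i)}"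
    by (intro Collect_cong) (auto simp: join_left)
  have e2: "{i. 1 \<le> i \<and> i \<le> m - 1 \<and> ?J (Suc (k + i)) < ?J (Suc (Suc (k + i)))} =
      {i. 1 \<le> i \<and> i \<le> m - 1 \<and> \<tau> i < \<tau> (Suc i)}"
    by (intro Collect_cong) (auto simp: join_right join_right_Suc)
  have e3: "(0 < k \<and> ?J k < ?J (Suc k)) = (0 < k)"
    using join_le[of k] by (auto simp: join_mid)
  have e4: "(0 < m \<and> ?J (Suc k) < ?J (Suc (Suc k))) = False"
    using join_gt[of "Suc (Suc k)"] by (auto simp: join_mid)
  show ?thesis
    unfolding asc_def card_adjacent_split[where P = "\<lambda>i. ?J i < ?J (Suc i)"] e1 e2 e3 e4
    by simp
qed

text \<open>A new occurrence must use the ascent into the maximum: earlier ascents end too low to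
  exceed a letter of \<tau>, and the maximum cannot play the 1. With that ascent every letter of
  \<tau> can play the 2, being above all of \<sigma>.\<close>

lemma pat_13_2_join:
  "pat_13_2 (Suc (k + m)) (join k m \<sigma> \<tau>) = pat_13_2 k \<sigma> + pat_13_2 m \<tau> + (if k = 0 then 0 else m)"
proof -
  let ?J = "join k m \<sigma> \<tau>"
  let ?P = "\<lambda>i j. Suc i < j \<and> ?J i < ?J j \<and> ?J j < ?J (Suc i)"
  have alt: "pat_13_2 n \<pi> = card {(i, j). 1 \<le> i \<and> i < j \<and> j \<le> n \<and>
      Suc i < j \<and> \<pi> i < \<pi> j \<and> \<pi> j < \<pi> (Suc i)}" for n \<pi>
    unfolding pat_13_2_def by (rule arg_cong[of _ _ card]) auto
  have "{(i, j). 1 \<le> i \<and> i < j \<and> j \<le> k \<and> ?P i j} =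
      {(i, j). 1 \<le> i \<and> i < j \<and> j \<le> k \<and> Suc i < j \<and> \<sigma> i < \<sigma> j \<and> \<sigma> j < \<sigma> (Suc i)}"
    by (auto simp: join_left)
  moreover have "{(i, j). 1 \<le> i \<and> i < j \<and> j \<le> m \<and> ?P (Suc (k + i)) (Suc (k + j))} =
      {(i, j). 1 \<le> i \<and> i < j \<and> j \<le> m \<and> Suc i < j \<and> \<tau> i < \<tau> j \<and> \<tau> j < \<tau> (Suc i)}"
    by (auto simp: join_right join_right_Suc)
  moreover have "{(i, j). 1 \<le> i \<and> i \<le> Suc k \<and> Suc k \<le> j \<and> i < j \<and> j \<le> Suc (k + m) \<and> ?P i j} =
      {i. i = k \<and> 0 < k} \<times> {Suc (Suc k)..Suc (k + m)}" (is "?L = ?R")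
  proof (intro set_eqI iffI)
    fix x assume x: "x \<in> ?L"
    obtain i j where ij: "x = (i, j)" by fastforce
    have "\<not> i < k"
      using x ij join_le[of "Suc i"] join_gt[of j] by (cases "j = Suc k") (auto simp: join_mid)
    moreover have "i \<noteq> Suc k"
      using x ij join_gt[of j] by (auto simp: join_mid)
    ultimately show "x \<in> ?R" using x ij by auto
  next
    fix x assume "x \<in> ?R"
    then show "x \<in> ?L"
      using join_le[of k] join_gt[of "snd x"] by (auto simp: join_mid)
  qed
  moreover have "card ({i. i = k \<and> 0 < k} \<times> {Suc (Suc k)..Suc (k + m)}) = (if k = 0 then 0 else m)"
    by (auto simp: card_cartesian_product)
  ultimately show ?thesis
    unfolding alt card_pairs_split[where P = ?P] by simp
qed

text \<open>Each value above \<open>\<tau> 1\<close> is taken at a later position. For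
  \<open>m = 0\<close> the formula also holds, as \<open>\<tau> 1 = 1\<close> and the subtraction
  truncates.\<close>

lemma card_greater_first: "card {j. 2 \<le> j \<and> j \<le> m \<and> \<tau> 1 < \<tau> j} = m - \<tau> 1"
proof -
  have "\<tau> ` {j. 2 \<le> j \<and> j \<le> m \<and> \<tau> 1 < \<tau> j} = {\<tau> 1<..m}"
  proof (intro set_eqI iffI)
    fix v assume v: "v \<in> {\<tau> 1<..m}"
    have "\<tau> ` {1..m} = {1..m}"
      using \<tau> unfolding perms_def by (simp add: permutes_image)
    then obtain j where "j \<in> {1..m}" "v = \<tau> j"
      using v by (metis atLeastAtMost_iff greaterThanAtMost_iff imageE less_one not_le less_nat_zero_code neq0_conv)
    moreover from this v have "j \<noteq> 1" by auto
    ultimately show "v \<in> \<tau> ` {j. 2 \<le> j \<and> j \<le> m \<and> \<tau> 1 < \<tau> j}" using v by force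
  qed (use perms_range[OF \<tau>] in force)
  then have "card (\<tau> ` {j. 2 \<le> j \<and> j \<le> m \<and> \<tau> 1 < \<tau> j}) = m - \<tau> 1"
    by (simp only: card_greaterThanAtMost)
  then show ?thesis
    by (subst (asm) card_image) (simp_all add: inj_on_def perms_eq_iff[OF \<tau>])
qed

text \<open>No letter of \<sigma> exceeds a letter from \<tau>, so the 3 of a new occurrence is the
  maximum. Its neighbour is the first letter of \<tau>, and the 2 is any later letter of \<tau>
  above that one.\<close>

lemma pat_31_2_join:
  "pat_31_2 (Suc (k + m)) (join k m \<sigma> \<tau>) = pat_31_2 k \<sigma> + pat_31_2 m \<tau> + (m - \<tau> 1)"
proof -
  let ?J = "join k m \<sigma> \<tau>"
  let ?P = "\<lambda>i j. Suc i < j \<and> ?J (Suc i) < ?J j \<and> ?J j < ?J i"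
  let ?f = "\<lambda>j. (Suc k, Suc (k + j))"
  have alt: "pat_31_2 n \<pi> = card {(i, j). 1 \<le> i \<and> i < j \<and> j \<le> n \<and>
      Suc i < j \<and> \<pi> (Suc i) < \<pi> j \<and> \<pi> j < \<pi> i}" for n \<pi>
    unfolding pat_31_2_def by (rule arg_cong[of _ _ card]) auto
  have "{(i, j). 1 \<le> i \<and> i < j \<and> j \<le> k \<and> ?P i j} =
      {(i, j). 1 \<le> i \<and> i < j \<and> j \<le> k \<and> Suc i < j \<and> \<sigma> (Suc i) < \<sigma> j \<and> \<sigma> j < \<sigma> i}"
    by (auto simp: join_left)
  moreover have "{(i, j). 1 \<le> i \<and> i < j \<and> j \<le> m \<and> ?P (Suc (k + i)) (Suc (k + j))} =
      {(i, j). 1 \<le> i \<and> i < j \<and> j \<le> m \<and> Suc i < j \<and> \<tau> (Suc i) < \<tau> j \<and> \<tau> j < \<tau> i}"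
    by (auto simp: join_right join_right_Suc)
  moreover have "{(i, j). 1 \<le> i \<and> i \<le> Suc k \<and> Suc k \<le> j \<and> i < j \<and> j \<le> Suc (k + m) \<and> ?P i j} =
      ?f ` {j. 2 \<le> j \<and> j \<le> m \<and> \<tau> 1 < \<tau> j}" (is "?L = ?R")
  proof (intro set_eqI iffI)
    fix x assume x: "x \<in> ?L"
    obtain i j where ij: "x = (i, j)" by fastforce
    have i: "i = Suc k"
      using x ij join_le[of i] join_gt[of j] by (cases "j = Suc k") (fastforce simp: join_mid)+
    define j' where "j' = j - Suc k"
    have j': "2 \<le> j'" "j' \<le> m" "j = Suc (k + j')"
      using x ij i by (auto simp: j'_def)
    have "\<tau> 1 < \<tau> j'"
      using x ij i j' join_right[of 1 m k \<sigma> \<tau>] join_right[of j' m k \<sigma> \<tau>] by auto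
    then show "x \<in> ?R" using ij i j' by auto
  next
    fix x assume "x \<in> ?R"
    then obtain j where j: "x = ?f j" "2 \<le> j" "j \<le> m" "\<tau> 1 < \<tau> j" by auto
    then have "?J (Suc (Suc k)) = k + \<tau> 1" "?J (Suc (k + j)) = k + \<tau> j"
      using join_right[of 1 m k \<sigma> \<tau>] join_right[of j m k \<sigma> \<tau>] by auto
    then show "x \<in> ?L"
      using j perms_range[OF \<tau>, of j] by (auto simp: join_mid)
  qed
  moreover have "card (?f ` {j. 2 \<le> j \<and> j \<le> m \<and> \<tau> 1 < \<tau> j}) = m - \<tau> 1"
    by (subst card_image) (auto intro: inj_onI simp: card_greater_first[simplified])
  ultimately show ?thesis
    unfolding alt card_pairs_split[where P = ?P] by simp
qed

text \<open>This is the recursion for the exponent of the additional weight in the 31-2 sums. If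
  \<sigma> is nonempty, the first letter is \<open>\<sigma> 1\<close>, and the maximum and all of
  \<tau> join the letters above it; otherwise the first letter is the maximum.\<close>

lemma join_first:
  "Suc (k + m) - join k m \<sigma> \<tau> 1 = (if k = 0 then 0 else (k - \<sigma> 1) + Suc m)"
proof (cases "k = 0")
  case True
  then show ?thesis using join_mid[of 0 m \<sigma> \<tau>] by simp
next
  case False
  then show ?thesis using perms_range[OF \<sigma>, of 1] by (simp add: join_left) linarith
qed

end

text \<open>A letter \<open>l\<close> as in the second alternative would complete a 231, so an
  ascent must lead into position \<open>i\<close>; the value \<open>n + 1\<close> at 0 excludes
  \<open>i = 1\<close>. Then \<open>\<pi> (i - 1) < \<pi> j\<close>, again to avoid 231, and
  \<open>(i - 1, j)\<close> is an occurrence of 13-2.\<close>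

lemma adi_star_eq_pat_13_2:
  assumes "\<pi> \<in> avoiding n [2, 3, 1]"
  shows "adi_star n \<pi> = pat_13_2 n \<pi>"
proof -
  have p: "\<pi> \<in> perms n" and av: "\<not> contains n \<pi> [2, 3, 1]"
    using assms by (auto simp: avoiding_def)
  have no: False if "1 \<le> a" "a < b" "b < c" "c \<le> n" "\<pi> c < \<pi> a" "\<pi> a < \<pi> b" for a b c
    using av that unfolding contains_231 by blast
  let ?A = "{(i, j). 1 \<le> i \<and> i < j \<and> j \<le> n \<and> \<pi> i > \<pi> j \<and>
    ((\<pi>(0 := n + 1)) (i - 1) < \<pi> i \<or> (\<exists>l. i < l \<and> l < j \<and> \<pi> l > \<pi> i))}"
  let ?B = "{(i, j). 1 \<le> i \<and> i + 1 < j \<and> j \<le> n \<and> \<pi> i < \<pi> j \<and> \<pi> j < \<pi> (i + 1)}"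
  let ?f = "\<lambda>(i, j). (Suc i, j)"
  have "?A = ?f ` ?B"
  proof (intro set_eqI iffI)
    fix x assume x: "x \<in> ?A"
    obtain i j where ij: "x = (i, j)" by fastforce
    have h: "1 \<le> i" "i < j" "j \<le> n" "\<pi> j < \<pi> i" using x ij by auto
    then have lt: "(\<pi>(0 := n + 1)) (i - 1) < \<pi> i"
      using x ij no by fastforce
    then have i: "1 \<le> i - 1"
      using h perms_range[OF p, of i] by (cases "i = 1") auto
    with lt have "\<pi> (i - 1) < \<pi> i" by (metis fun_upd_other not_one_le_zero)
    moreover have "\<pi> (i - 1) < \<pi> j"
      using no[of "i - 1" i j] perms_eq_iff[OF p, of "i - 1" j] i h calculation by force
    ultimately have "(i - 1, j) \<in> ?B" using h i by auto
    moreover have "x = ?f (i - 1, j)" using ij i by simp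
    ultimately show "x \<in> ?f ` ?B" by blast
  next
    fix x assume "x \<in> ?f ` ?B"
    then show "x \<in> ?A" by auto
  qed
  moreover have "inj_on ?f ?B" by (auto intro: inj_onI)
  ultimately show ?thesis
    unfolding adi_star_def pat_13_2_def Let_def by (simp add: card_image)
qed

subsection \<open>Generating functions\<close>

definition wsum_231 :: "(nat \<Rightarrow> (nat \<Rightarrow> nat) \<Rightarrow> 'a::field) \<Rightarrow> nat \<Rightarrow> 'a" where
  "wsum_231 w n = (\<Sum>\<pi>\<in>avoiding n [2, 3, 1]. w n \<pi>)"

lemma avoiding_0: "avoiding 0 [2, 3, 1] = {id}"
  by (auto simp: avoiding_def contains_3 perms_def)

lemma wsum_231_0 [simp]: "wsum_231 w 0 = w 0 id"
  unfolding wsum_231_def avoiding_0 by simp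

text \<open>The weights of the whole and of the two parts may differ: in the 31-2 recursions the
  right part carries an additional factor.\<close>

lemma wsum_231_Suc:
  assumes "\<And>k m \<sigma> \<tau>. \<sigma> \<in> perms k \<Longrightarrow> \<tau> \<in> perms m \<Longrightarrow>
    w (Suc (k + m)) (join k m \<sigma> \<tau>) = c k m * u k \<sigma> * v m \<tau>"
  shows "wsum_231 w (Suc n) = (\<Sum>k=0..n. c k (n - k) * wsum_231 u k * wsum_231 v (n - k))"
proof -
  have "w (Suc n) (join k (n - k) \<sigma> \<tau>) = c k (n - k) * u k \<sigma> * v (n - k) \<tau>"
    if "k \<in> {0..n}" "\<sigma> \<in> avoiding k [2, 3, 1]" "\<tau> \<in> avoiding (n - k) [2, 3, 1]" for k \<sigma> \<tau>
    using assms[of \<sigma> k \<tau> "n - k"] that by (simp add: avoiding_def)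
  then have "wsum_231 w (Suc n) = (\<Sum>k=0..n. \<Sum>\<sigma>\<in>avoiding k [2, 3, 1].
      \<Sum>\<tau>\<in>avoiding (n - k) [2, 3, 1]. c k (n - k) * u k \<sigma> * v (n - k) \<tau>)"
    unfolding wsum_231_def sum_avoiding_231 by (intro sum.cong refl) simp
  also have "\<dots> = (\<Sum>k=0..n. c k (n - k) * wsum_231 u k * wsum_231 v (n - k))"
    unfolding wsum_231_def
    by (intro sum.cong refl) (simp only: sum_distrib_left[symmetric] sum_distrib_right[symmetric])
  finally show ?thesis .
qed

lemma fps_eq_one_plus_X_mult:
  assumes "F $ 0 = 1" "\<And>n. F $ Suc n = R $ n"
  shows "F = 1 + fps_X * (R :: 'a::field fps)"
proof (rule fps_ext)
  show "F $ n = (1 + fps_X * R) $ n" for n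
    using assms by (cases n) auto
qed

lemma zero_stats [simp]:
  "des 0 \<pi> = 0" "asc 0 \<pi> = 0" "pat_13_2 0 \<pi> = 0" "pat_31_2 0 \<pi> = 0"
proof -
  have no: "{i. 1 \<le> i \<and> i \<le> 0 - 1 \<and> P i} = {}" for P :: "nat \<Rightarrow> bool" by auto
  have no2: "{(i, j). 1 \<le> i \<and> i + 1 < j \<and> j \<le> 0 \<and> P i j} = {}" for P :: "nat \<Rightarrow> nat \<Rightarrow> bool" by auto
  show "des 0 \<pi> = 0" "asc 0 \<pi> = 0" "pat_13_2 0 \<pi> = 0" "pat_31_2 0 \<pi> = 0"
    unfolding des_def asc_def pat_13_2_def pat_31_2_def no no2 by simp_all
qed

lemma qt_catalan_des_13_2:
  fixes t q :: "'a::field"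
  shows "qt_catalan n t q = (\<Sum>\<pi>\<in>avoiding n [2, 3, 1]. t ^ des n \<pi> * q ^ pat_13_2 n \<pi>)"
proof -
  define w where "w n \<pi> = t ^ des n \<pi> * q ^ pat_13_2 n \<pi>" for n \<pi>
  define F where "F = Abs_fps (wsum_231 w)"
  \<comment> \<open>\<open>T\<close> counts the right part, with \<open>t\<close> for the descent
    out of the maximum when that part is nonempty.\<close>
  define T where "T = 1 + fps_const t * (F - 1)"
  have F0: "F $ 0 = 1" by (simp add: F_def w_def)
  have rec: "wsum_231 w (Suc n) = (\<Sum>k=0..n. ((if n - k = 0 then 1 else t) *
      (if k = 0 then 1 else q ^ (n - k))) * wsum_231 w k * wsum_231 w (n - k))" for n
    by (rule wsum_231_Suc)
      (auto simp: w_def des_join pat_13_2_join power_add mult_ac)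
  \<comment> \<open>The factor \<open>1\<close> selects an empty left part and \<open>F - 1\<close>
    a nonempty one, for which each letter of the right part contributes a \<open>q\<close>. Writing
    \<open>1 * T\<close> makes both summands convolutions over the same \<open>k\<close>.\<close>
  have "F = 1 + fps_X * (1 * T + (F - 1) * fps_scale q T)"
  proof (rule fps_eq_one_plus_X_mult[OF F0])
    fix n
    show "F $ Suc n = (1 * T + (F - 1) * fps_scale q T) $ n"
      unfolding fps_add_nth fps_mult_nth sum.distrib[symmetric]
      using F0 by (auto simp: F_def T_def rec w_def[of 0] intro!: sum.cong)
  qed
  then have "F = 1 + fps_X * F + fps_const t * fps_X * fps_scale q F * (F - 1)"
    unfolding T_def by (simp add: algebra_simps)
  then have "qt_catalan n t q = F $ n" by (rule qt_catalan_unique)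
  then show ?thesis by (simp add: F_def wsum_231_def w_def)
qed

text \<open>Counting ascents moves the \<open>t\<close> to the left part: both \<open>t\<close> and
  the powers of \<open>q\<close> now appear exactly when \<sigma> is nonempty.\<close>

lemma qt_catalan_asc_13_2:
  fixes t q :: "'a::field"
  shows "qt_catalan n t q = (\<Sum>\<pi>\<in>avoiding n [2, 3, 1]. t ^ asc n \<pi> * q ^ pat_13_2 n \<pi>)"
proof -
  define w where "w n \<pi> = t ^ asc n \<pi> * q ^ pat_13_2 n \<pi>" for n \<pi>
  define F where "F = Abs_fps (wsum_231 w)"
  have F0: "F $ 0 = 1" by (simp add: F_def w_def)
  have rec: "wsum_231 w (Suc n) = (\<Sum>k=0..n.
      (if k = 0 then 1 else t * q ^ (n - k)) * wsum_231 w k * wsum_231 w (n - k))" for n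
    by (rule wsum_231_Suc)
      (auto simp: w_def asc_join pat_13_2_join power_add mult_ac)
  have "F = 1 + fps_X * (1 * F + (fps_const t * (F - 1)) * fps_scale q F)"
  proof (rule fps_eq_one_plus_X_mult[OF F0])
    fix n
    show "F $ Suc n = (1 * F + (fps_const t * (F - 1)) * fps_scale q F) $ n"
      unfolding fps_add_nth fps_mult_nth[of 1] fps_mult_nth[of "fps_const t * (F - 1)"]
        sum.distrib[symmetric]
      using F0 by (auto simp: F_def rec w_def[of 0] intro!: sum.cong)
  qed
  then have "F = 1 + fps_X * F + fps_const t * fps_X * fps_scale q F * (F - 1)"
    by (simp add: algebra_simps)
  then have "qt_catalan n t q = F $ n" by (rule qt_catalan_unique)
  then show ?thesis by (simp add: F_def wsum_231_def w_def)
qed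

text \<open>The recursion for \<open>F\<close> involves the series \<open>B\<close> with the
  additional weight on the right part, so \<open>B\<close> needs its own recursion. After
  elimination, \<open>T\<close> satisfies the equation of the second tail of the continued
  fraction.\<close>

lemma qt_catalan_des_31_2:
  fixes t q :: "'a::field"
  shows "qt_catalan n t q = (\<Sum>\<pi>\<in>avoiding n [2, 3, 1]. t ^ des n \<pi> * q ^ pat_31_2 n \<pi>)"
proof -
  define w where "w n \<pi> = t ^ des n \<pi> * q ^ pat_31_2 n \<pi>" for n \<pi>
  define v where "v n \<pi> = w n \<pi> * q ^ (n - \<pi> 1)" for n \<pi>
  define F where "F = Abs_fps (wsum_231 w)"
  define B where "B = Abs_fps (wsum_231 v)"
  define T where "T = 1 + fps_const t * (B - 1)"
  have F0: "F $ 0 = 1" by (simp add: F_def w_def)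
  have B0: "B $ 0 = 1" by (simp add: B_def v_def w_def)
  have recF: "wsum_231 w (Suc n) = (\<Sum>k=0..n.
      (if n - k = 0 then 1 else t) * wsum_231 w k * wsum_231 v (n - k))" for n
    by (rule wsum_231_Suc)
      (auto simp: v_def w_def des_join pat_31_2_join power_add mult_ac)
  \<comment> \<open>By \<open>join_first\<close>, a nonempty left part contributes one
    \<open>q\<close> for the maximum and one for each letter of the right part.\<close>
  have recB: "wsum_231 v (Suc n) = (\<Sum>k=0..n. ((if n - k = 0 then 1 else t) *
      (if k = 0 then 1 else q * q ^ (n - k))) * wsum_231 v k * wsum_231 v (n - k))" for n
    by (rule wsum_231_Suc)
      (auto simp: v_def w_def des_join pat_31_2_join join_first[simplified] power_add mult_ac)
  have F: "F = 1 + fps_X * (F * T)"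
  proof (rule fps_eq_one_plus_X_mult[OF F0])
    fix n
    show "F $ Suc n = (F * T) $ n"
      unfolding fps_mult_nth
      using F0 B0 by (auto simp: F_def B_def T_def recF v_def[of 0] w_def[of 0] intro!: sum.cong)
  qed
  have B: "B = 1 + fps_X * (1 * T + (fps_const q * (B - 1)) * fps_scale q T)"
  proof (rule fps_eq_one_plus_X_mult[OF B0])
    fix n
    show "B $ Suc n = (1 * T + (fps_const q * (B - 1)) * fps_scale q T) $ n"
      unfolding fps_add_nth fps_mult_nth[of 1] fps_mult_nth[of "fps_const q * (B - 1)"]
        sum.distrib[symmetric]
      using B0 by (auto simp: B_def T_def recB v_def[of 0] w_def[of 0] intro!: sum.cong)
  qed
  have Fq: "fps_scale q F = 1 + fps_const q * fps_X * (fps_scale q F * fps_scale q T)"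
    using arg_cong[OF F, of "fps_scale q"] by simp
  \<comment> \<open>By \<open>Fq\<close>, \<open>F(q z)\<close> is the inverse of
    \<open>1 - q z T(q z)\<close>, while \<open>B\<close> reads
    \<open>(B - 1) (1 - q z T(q z)) = z T\<close>.\<close>
  have "B - 1 = fps_X * T * fps_scale q F"
    using B Fq by algebra
  then have "T = 1 + fps_const t * fps_X * T * fps_scale q F"
    unfolding T_def by (simp add: mult.assoc)
  then have "F = 1 + fps_X * F + fps_const t * fps_X * fps_scale q F * (F - 1)"
    using F by algebra
  then have "qt_catalan n t q = F $ n" by (rule qt_catalan_unique)
  then show ?thesis by (simp add: F_def wsum_231_def w_def)
qed

lemma qt_catalan_asc_31_2:
  fixes t q :: "'a::field"
  shows "qt_catalan n t q = (\<Sum>\<pi>\<in>avoiding n [2, 3, 1]. t ^ asc n \<pi> * q ^ pat_31_2 n \<pi>)"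
proof -
  define w where "w n \<pi> = t ^ asc n \<pi> * q ^ pat_31_2 n \<pi>" for n \<pi>
  define v where "v n \<pi> = w n \<pi> * q ^ (n - \<pi> 1)" for n \<pi>
  define F where "F = Abs_fps (wsum_231 w)"
  define B where "B = Abs_fps (wsum_231 v)"
  have F0: "F $ 0 = 1" by (simp add: F_def w_def)
  have B0: "B $ 0 = 1" by (simp add: B_def v_def w_def)
  have recF: "wsum_231 w (Suc n) = (\<Sum>k=0..n.
      (if k = 0 then 1 else t) * wsum_231 w k * wsum_231 v (n - k))" for n
    by (rule wsum_231_Suc)
      (auto simp: v_def w_def asc_join pat_31_2_join power_add mult_ac)
  have recB: "wsum_231 v (Suc n) = (\<Sum>k=0..n.
      (if k = 0 then 1 else t * q * q ^ (n - k)) * wsum_231 v k * wsum_231 v (n - k))" for n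
    by (rule wsum_231_Suc)
      (auto simp: v_def w_def asc_join pat_31_2_join join_first[simplified] power_add mult_ac)
  have F: "F = 1 + fps_X * (1 * B + (fps_const t * (F - 1)) * B)"
  proof (rule fps_eq_one_plus_X_mult[OF F0])
    fix n
    show "F $ Suc n = (1 * B + (fps_const t * (F - 1)) * B) $ n"
      unfolding fps_add_nth fps_mult_nth[of 1] fps_mult_nth[of "fps_const t * (F - 1)"]
        sum.distrib[symmetric]
      using F0 B0 by (auto simp: F_def B_def recF v_def[of 0] w_def[of 0] intro!: sum.cong)
  qed
  have B: "B = 1 + fps_X * (1 * B + (fps_const (t * q) * (B - 1)) * fps_scale q B)"
  proof (rule fps_eq_one_plus_X_mult[OF B0])
    fix n
    show "B $ Suc n = (1 * B + (fps_const (t * q) * (B - 1)) * fps_scale q B) $ n"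
      unfolding fps_add_nth fps_mult_nth[of 1] fps_mult_nth[of "fps_const (t * q) * (B - 1)"]
        sum.distrib[symmetric]
      using B0 by (auto simp: B_def recB v_def[of 0] w_def[of 0] intro!: sum.cong)
  qed
  \<comment> \<open>Chosen so that \<open>B(q z)\<close> enters only through \<open>u\<close>:
    \<open>Fq\<close> then says \<open>1 / (1 - u) = 1 + t (F(q z) - 1)\<close>, which trades
    \<open>B(q z)\<close> for \<open>F(q z)\<close>.\<close>
  define u where "u = fps_const t * fps_const q * fps_X * fps_scale q B"
  have Fq: "fps_const t * (fps_scale q F - 1) * (1 - u) = u"
  proof -
    have "fps_scale q F = 1 + fps_const q * fps_X *
        (fps_scale q B + fps_const t * (fps_scale q F - 1) * fps_scale q B)"
      using arg_cong[OF F, of "fps_scale q"] by simp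
    then show ?thesis unfolding u_def by algebra
  qed
  have Bu: "B * (1 - fps_X - u) = 1 - u"
    using B unfolding u_def fps_const_mult[symmetric] by algebra
  \<comment> \<open>Multiplying \<open>F\<close> by \<open>1 - fps_X - u\<close> removes
    \<open>B\<close> through \<open>Bu\<close>; \<open>Fq\<close> then removes the remaining
    dependence on \<open>B(q z)\<close> up to the factor \<open>1 - u\<close>, which has constant
    term 1.\<close>
  have "(1 - u) * (F - (1 + fps_X * F + fps_const t * fps_X * fps_scale q F * (F - 1))) = 0"
    using Bu Fq F by algebra
  moreover have "1 - u \<noteq> 0"
  proof
    assume "1 - u = 0"
    then have "(1 - u) $ 0 = 0" by simp
    then show False by (simp add: u_def mult.assoc)
  qed
  ultimately have "F = 1 + fps_X * F + fps_const t * fps_X * fps_scale q F * (F - 1)" by simp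
  then have "qt_catalan n t q = F $ n" by (rule qt_catalan_unique)
  then show ?thesis by (simp add: F_def wsum_231_def w_def)
qed

subsection \<open>Reverse-complement and complement\<close>

definition rev_compl :: "nat \<Rightarrow> (nat \<Rightarrow> nat) \<Rightarrow> nat \<Rightarrow> nat" where
  "rev_compl n \<pi> i = (if 1 \<le> i \<and> i \<le> n then n + 1 - \<pi> (n + 1 - i) else i)"

definition compl :: "nat \<Rightarrow> (nat \<Rightarrow> nat) \<Rightarrow> nat \<Rightarrow> nat" where
  "compl n \<pi> i = (if 1 \<le> i \<and> i \<le> n then n + 1 - \<pi> i else i)"

lemma compl_less_iff:
  assumes "\<pi> \<in> perms n" "1 \<le> i" "i \<le> n" "1 \<le> j" "j \<le> n"
  shows "compl n \<pi> i < compl n \<pi> j \<longleftrightarrow> \<pi> j < \<pi> i"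
  using perms_range[OF assms(1-3)] perms_range[OF assms(1,4,5)] assms(2-5)
  by (auto simp: compl_def)

lemma rev_compl_less_iff:
  assumes "\<pi> \<in> perms n" "1 \<le> i" "i \<le> n" "1 \<le> j" "j \<le> n"
  shows "rev_compl n \<pi> (n + 1 - i) < rev_compl n \<pi> (n + 1 - j) \<longleftrightarrow> \<pi> j < \<pi> i"
  using perms_range[OF assms(1-3)] perms_range[OF assms(1,4,5)] assms(2-5)
  by (auto simp: rev_compl_def)

lemma compl_perms: "\<pi> \<in> perms n \<Longrightarrow> compl n \<pi> \<in> perms n"
proof (rule permsI)
  assume p: "\<pi> \<in> perms n"
  show "1 \<le> compl n \<pi> i \<and> compl n \<pi> i \<le> n" if "1 \<le> i" "i \<le> n" for i
    using perms_range[OF p that] that by (auto simp: compl_def)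
  show "compl n \<pi> i \<noteq> compl n \<pi> j" if "1 \<le> i" "i < j" "j \<le> n" for i j
    using compl_less_iff[OF p, of i j] compl_less_iff[OF p, of j i] perms_eq_iff[OF p, of i j] that
    by (metis dual_order.trans less_imp_le linorder_neqE_nat less_irrefl)
qed (auto simp: compl_def)

lemma rev_compl_perms: "\<pi> \<in> perms n \<Longrightarrow> rev_compl n \<pi> \<in> perms n"
proof (rule permsI)
  assume p: "\<pi> \<in> perms n"
  show "1 \<le> rev_compl n \<pi> i \<and> rev_compl n \<pi> i \<le> n" if "1 \<le> i" "i \<le> n" for i
  proof -
    have "1 \<le> n + 1 - i" "n + 1 - i \<le> n" using that by auto
    from perms_range[OF p this] that show ?thesis by (auto simp: rev_compl_def)
  qed
  show "rev_compl n \<pi> i \<noteq> rev_compl n \<pi> j" if ij: "1 \<le> i" "i < j" "j \<le> n" for i j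
  proof -
    have "1 \<le> n + 1 - i" "n + 1 - i \<le> n" "1 \<le> n + 1 - j" "n + 1 - j \<le> n" "n + 1 - i \<noteq> n + 1 - j"
      using ij by auto
    then have "\<pi> (n + 1 - i) \<noteq> \<pi> (n + 1 - j)" "\<pi> (n + 1 - i) \<le> n" "\<pi> (n + 1 - j) \<le> n"
      using perms_range[OF p] perms_eq_iff[OF p] by blast+
    then show ?thesis using ij by (simp add: rev_compl_def)
  qed
qed (auto simp: rev_compl_def)

lemma compl_compl: "\<pi> \<in> perms n \<Longrightarrow> compl n (compl n \<pi>) = \<pi>"
proof
  fix i assume p: "\<pi> \<in> perms n"
  show "compl n (compl n \<pi>) i = \<pi> i"
    using perms_range[OF p, of i] perms_outside[OF p, of i]
    by (cases "i = 0 \<or> n < i") (auto simp: compl_def)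
qed

lemma rev_compl_rev_compl: "\<pi> \<in> perms n \<Longrightarrow> rev_compl n (rev_compl n \<pi>) = \<pi>"
proof
  fix i assume p: "\<pi> \<in> perms n"
  show "rev_compl n (rev_compl n \<pi>) i = \<pi> i"
  proof (cases "1 \<le> i \<and> i \<le> n")
    case True
    then have "1 \<le> n + 1 - i" "n + 1 - i \<le> n" "n + 1 - (n + 1 - i) = i" by auto
    then show ?thesis using perms_range[OF p, of i] True by (simp add: rev_compl_def)
  next
    case False
    then show ?thesis using perms_outside[OF p, of i] by (auto simp: rev_compl_def)
  qed
qed

lemma contains_compl:
  assumes "\<pi> \<in> perms n"
  shows "contains n (compl n \<pi>) [2, 1, 3] \<longleftrightarrow> contains n \<pi> [2, 3, 1]"
  unfolding contains_213 contains_231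
proof (intro ex_cong1)
  fix i j k
  show "(1 \<le> i \<and> i < j \<and> j < k \<and> k \<le> n \<and> compl n \<pi> j < compl n \<pi> i \<and> compl n \<pi> i < compl n \<pi> k) \<longleftrightarrow>
    (1 \<le> i \<and> i < j \<and> j < k \<and> k \<le> n \<and> \<pi> k < \<pi> i \<and> \<pi> i < \<pi> j)"
  proof (cases "1 \<le> i \<and> i < j \<and> j < k \<and> k \<le> n")
    case True
    then show ?thesis
      using compl_less_iff[OF assms, of j i] compl_less_iff[OF assms, of i k] by auto
  qed auto
qed

text \<open>Reflecting the positions and the values exchanges 231 with 312 and 132 with 213. One
  direction of each suffices because \<open>rev_compl\<close> is an involution.\<close>

lemma contains_rev_complI:
  assumes p: "\<pi> \<in> perms n"
  shows "contains n (rev_compl n \<pi>) [3, 1, 2] \<Longrightarrow> contains n \<pi> [2, 3, 1]"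
    and "contains n (rev_compl n \<pi>) [2, 3, 1] \<Longrightarrow> contains n \<pi> [3, 1, 2]"
    and "contains n (rev_compl n \<pi>) [1, 3, 2] \<Longrightarrow> contains n \<pi> [2, 1, 3]"
    and "contains n (rev_compl n \<pi>) [2, 1, 3] \<Longrightarrow> contains n \<pi> [1, 3, 2]"
proof -
  let ?r = "\<lambda>i. n + 1 - i"
  have less: "rev_compl n \<pi> i < rev_compl n \<pi> j \<longleftrightarrow> \<pi> (?r j) < \<pi> (?r i)"
    if "1 \<le> i" "i \<le> n" "1 \<le> j" "j \<le> n" for i j
    using rev_compl_less_iff[OF p, of "?r i" "?r j"] that by simp
  have rev: "1 \<le> ?r k \<and> ?r k < ?r j \<and> ?r j < ?r i \<and> ?r i \<le> n"
    if "1 \<le> i" "i < j" "j < k" "k \<le> n" for i j k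
    using that by auto
  {
    assume "contains n (rev_compl n \<pi>) [3, 1, 2]"
    then obtain i j k where h: "1 \<le> i" "i < j" "j < k" "k \<le> n"
      "rev_compl n \<pi> j < rev_compl n \<pi> k" "rev_compl n \<pi> k < rev_compl n \<pi> i"
      unfolding contains_312 by blast
    then show "contains n \<pi> [2, 3, 1]"
      unfolding contains_231 using rev[OF h(1-4)] less[of j k] less[of k i]
      by (intro exI[of _ "?r k"] exI[of _ "?r j"] exI[of _ "?r i"]) auto
  next
    assume "contains n (rev_compl n \<pi>) [2, 3, 1]"
    then obtain i j k where h: "1 \<le> i" "i < j" "j < k" "k \<le> n"
      "rev_compl n \<pi> k < rev_compl n \<pi> i" "rev_compl n \<pi> i < rev_compl n \<pi> j"
      unfolding contains_231 by blast
    then show "contains n \<pi> [3, 1, 2]"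
      unfolding contains_312 using rev[OF h(1-4)] less[of k i] less[of i j]
      by (intro exI[of _ "?r k"] exI[of _ "?r j"] exI[of _ "?r i"]) auto
  next
    assume "contains n (rev_compl n \<pi>) [1, 3, 2]"
    then obtain i j k where h: "1 \<le> i" "i < j" "j < k" "k \<le> n"
      "rev_compl n \<pi> i < rev_compl n \<pi> k" "rev_compl n \<pi> k < rev_compl n \<pi> j"
      unfolding contains_132 by blast
    then show "contains n \<pi> [2, 1, 3]"
      unfolding contains_213 using rev[OF h(1-4)] less[of i k] less[of k j]
      by (intro exI[of _ "?r k"] exI[of _ "?r j"] exI[of _ "?r i"]) auto
  next
    assume "contains n (rev_compl n \<pi>) [2, 1, 3]"
    then obtain i j k where h: "1 \<le> i" "i < j" "j < k" "k \<le> n"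
      "rev_compl n \<pi> j < rev_compl n \<pi> i" "rev_compl n \<pi> i < rev_compl n \<pi> k"
      unfolding contains_213 by blast
    then show "contains n \<pi> [1, 3, 2]"
      unfolding contains_132 using rev[OF h(1-4)] less[of j i] less[of i k]
      by (intro exI[of _ "?r k"] exI[of _ "?r j"] exI[of _ "?r i"]) auto
  }
qed

lemma sum_avoiding_213:
  "(\<Sum>\<pi>\<in>avoiding n [2, 1, 3]. f \<pi>) = (\<Sum>\<pi>\<in>avoiding n [2, 3, 1]. f (compl n \<pi>))"
proof (rule sum.reindex_bij_witness[of _ "compl n" "compl n"])
  fix \<pi> assume "\<pi> \<in> avoiding n [2, 1, 3]"
  then have p: "\<pi> \<in> perms n" and av: "\<not> contains n \<pi> [2, 1, 3]"
    unfolding avoiding_def by blast+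
  show "compl n (compl n \<pi>) = \<pi>" using p by (rule compl_compl)
  then show "f (compl n (compl n \<pi>)) = f \<pi>" by simp
  have "\<not> contains n (compl n \<pi>) [2, 3, 1]"
    using contains_compl[OF compl_perms[OF p]] av unfolding compl_compl[OF p] by blast
  then show "compl n \<pi> \<in> avoiding n [2, 3, 1]"
    using compl_perms[OF p] unfolding avoiding_def by blast
next
  fix \<pi> assume "\<pi> \<in> avoiding n [2, 3, 1]"
  then have p: "\<pi> \<in> perms n" and av: "\<not> contains n \<pi> [2, 3, 1]"
    unfolding avoiding_def by blast+
  show "compl n (compl n \<pi>) = \<pi>" using p by (rule compl_compl)
  show "compl n \<pi> \<in> avoiding n [2, 1, 3]"
    using compl_perms[OF p] av contains_compl[OF p]
    unfolding avoiding_def by blast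
qed

lemma sum_avoiding_rev_compl:
  assumes "\<And>\<pi>. \<pi> \<in> perms n \<Longrightarrow> contains n (rev_compl n \<pi>) p' \<Longrightarrow> contains n \<pi> p"
    and "\<And>\<pi>. \<pi> \<in> perms n \<Longrightarrow> contains n (rev_compl n \<pi>) p \<Longrightarrow> contains n \<pi> p'"
  shows "(\<Sum>\<pi>\<in>avoiding n p'. f \<pi>) = (\<Sum>\<pi>\<in>avoiding n p. f (rev_compl n \<pi>))"
  by (rule sum.reindex_bij_witness[of _ "rev_compl n" "rev_compl n"])
    (use assms in \<open>auto simp: avoiding_def rev_compl_rev_compl rev_compl_perms\<close>)

lemma sum_avoiding_312:
  "(\<Sum>\<pi>\<in>avoiding n [3, 1, 2]. f \<pi>) = (\<Sum>\<pi>\<in>avoiding n [2, 3, 1]. f (rev_compl n \<pi>))"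
  by (rule sum_avoiding_rev_compl) (fact contains_rev_complI)+

lemma sum_avoiding_132:
  "(\<Sum>\<pi>\<in>avoiding n [1, 3, 2]. f \<pi>) = (\<Sum>\<pi>\<in>avoiding n [2, 1, 3]. f (rev_compl n \<pi>))"
  by (rule sum_avoiding_rev_compl) (fact contains_rev_complI)+

section \<open>Descents and vincular patterns under the symmetries\<close>

lemma des_compl: "\<pi> \<in> perms n \<Longrightarrow> des n (compl n \<pi>) = asc n \<pi>"
  unfolding des_def asc_def
  by (rule arg_cong[of _ _ card], rule Collect_cong) (auto simp: compl_less_iff)

lemma pat_31_2_compl: "\<pi> \<in> perms n \<Longrightarrow> pat_31_2 n (compl n \<pi>) = pat_13_2 n \<pi>"
  unfolding pat_31_2_def pat_13_2_def
  by (rule arg_cong[of _ _ card]) (auto simp: compl_less_iff)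

lemma pat_13_2_compl: "\<pi> \<in> perms n \<Longrightarrow> pat_13_2 n (compl n \<pi>) = pat_31_2 n \<pi>"
  unfolding pat_31_2_def pat_13_2_def
  by (rule arg_cong[of _ _ card]) (auto simp: compl_less_iff)

text \<open>The bounds by \<open>a\<close> and \<open>b\<close> make truncated subtraction an
  involution on both index sets.\<close>

lemma card_reflect:
  fixes a b :: nat
  assumes "\<And>i j. Q i j \<Longrightarrow> i \<le> a \<and> j \<le> b" "\<And>i j. Q' i j \<Longrightarrow> i \<le> a \<and> j \<le> b"
    and "\<And>i j. i \<le> a \<Longrightarrow> j \<le> b \<Longrightarrow> Q' (a - i) (b - j) \<longleftrightarrow> Q i j"
  shows "card {(i, j). Q' i j} = card {(i, j). Q i j}"
proof (rule bij_betw_same_card)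
  let ?f = "\<lambda>(i, j). (a - i, b - j)"
  have Q: "Q (a - i) (b - j)" if "Q' i j" for i j
    using assms(2)[OF that] assms(3)[of "a - i" "b - j"] that by simp
  show "bij_betw ?f {(i, j). Q' i j} {(i, j). Q i j}"
    by (rule bij_betw_byWitness[where f' = ?f]) (auto dest: assms(1,2) simp: assms Q)
qed

text \<open>The adjacent pair starting at \<open>i\<close> is reflected to the one starting at
  \<open>n - i\<close>, whereas the single position \<open>j\<close> goes to
  \<open>n + 1 - j\<close>. Hence the different reflection constants for \<open>i\<close> and
  \<open>j\<close> in the pattern counts below.\<close>

lemma rev_compl_adjacent_less_iff:
  assumes "\<pi> \<in> perms n" "1 \<le> i" "i + 1 < j" "j \<le> n"
  shows "rev_compl n \<pi> (n - i) < rev_compl n \<pi> (n + 1 - j) \<longleftrightarrow> \<pi> j < \<pi> (i + 1)"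
    and "rev_compl n \<pi> (n + 1 - j) < rev_compl n \<pi> (n - i) \<longleftrightarrow> \<pi> (i + 1) < \<pi> j"
    and "rev_compl n \<pi> (n - i + 1) < rev_compl n \<pi> (n + 1 - j) \<longleftrightarrow> \<pi> j < \<pi> i"
    and "rev_compl n \<pi> (n + 1 - j) < rev_compl n \<pi> (n - i + 1) \<longleftrightarrow> \<pi> i < \<pi> j"
  using assms rev_compl_less_iff[OF assms(1), of "i + 1" j] rev_compl_less_iff[OF assms(1), of j "i + 1"]
    rev_compl_less_iff[OF assms(1), of i j] rev_compl_less_iff[OF assms(1), of j i]
  by (simp_all add: Suc_diff_le)

text \<open>Reversal and complement each turn a descent into an ascent; together they move a descent
  from \<open>i\<close> to \<open>n - i\<close>.\<close>

lemma des_rev_compl: assumes p: "\<pi> \<in> perms n" shows "des n (rev_compl n \<pi>) = des n \<pi>"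
proof -
  have iff: "rev_compl n \<pi> (n - i) > rev_compl n \<pi> (Suc (n - i)) \<longleftrightarrow> \<pi> i > \<pi> (Suc i)"
    if "1 \<le> i" "i \<le> n - 1" for i
    using rev_compl_less_iff[OF p, of i "Suc i"] that by (simp add: Suc_diff_le)
  have "bij_betw (\<lambda>i. n - i) {i. 1 \<le> i \<and> i \<le> n - 1 \<and> rev_compl n \<pi> i > rev_compl n \<pi> (Suc i)}
      {i. 1 \<le> i \<and> i \<le> n - 1 \<and> \<pi> i > \<pi> (Suc i)}"
  proof (rule bij_betw_byWitness[where f' = "\<lambda>i. n - i"])
    show "(\<lambda>i. n - i) ` {i. 1 \<le> i \<and> i \<le> n - 1 \<and> rev_compl n \<pi> i > rev_compl n \<pi> (Suc i)} \<subseteq>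
        {i. 1 \<le> i \<and> i \<le> n - 1 \<and> \<pi> i > \<pi> (Suc i)}"
    proof clarify
      fix i assume i: "1 \<le> i" "i \<le> n - 1" "rev_compl n \<pi> i > rev_compl n \<pi> (Suc i)"
      then show "1 \<le> n - i \<and> n - i \<le> n - 1 \<and> \<pi> (n - i) > \<pi> (Suc (n - i))"
        using iff[of "n - i"] by auto
    qed
  qed (auto simp: iff)
  then show ?thesis unfolding des_def by (rule bij_betw_same_card)
qed

lemma pat_2_13_rev_compl:
  assumes p: "\<pi> \<in> perms n" shows "pat_2_13 n (rev_compl n \<pi>) = pat_13_2 n \<pi>"
  unfolding pat_2_13_def pat_13_2_def
proof (rule card_reflect[of _ n "n + 1"])
  fix i j :: nat assume "i \<le> n" "j \<le> n + 1"
  then show "(1 \<le> n + 1 - j \<and> n + 1 - j < n - i \<and> n - i < n \<and>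
      rev_compl n \<pi> (n - i) < rev_compl n \<pi> (n + 1 - j) \<and>
      rev_compl n \<pi> (n + 1 - j) < rev_compl n \<pi> (n - i + 1)) \<longleftrightarrow>
    (1 \<le> i \<and> i + 1 < j \<and> j \<le> n \<and> \<pi> i < \<pi> j \<and> \<pi> j < \<pi> (i + 1))"
  proof (cases "1 \<le> i \<and> i + 1 < j \<and> j \<le> n")
    case True
    then show ?thesis using rev_compl_adjacent_less_iff[OF p, of i j] by auto
  qed auto
qed auto

lemma pat_2_31_rev_compl:
  assumes p: "\<pi> \<in> perms n" shows "pat_2_31 n (rev_compl n \<pi>) = pat_31_2 n \<pi>"
  unfolding pat_2_31_def pat_31_2_def
proof (rule card_reflect[of _ n "n + 1"])
  fix i j :: nat assume "i \<le> n" "j \<le> n + 1"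
  then show "(1 \<le> n + 1 - j \<and> n + 1 - j < n - i \<and> n - i < n \<and>
      rev_compl n \<pi> (n - i + 1) < rev_compl n \<pi> (n + 1 - j) \<and>
      rev_compl n \<pi> (n + 1 - j) < rev_compl n \<pi> (n - i)) \<longleftrightarrow>
    (1 \<le> i \<and> i + 1 < j \<and> j \<le> n \<and> \<pi> (i + 1) < \<pi> j \<and> \<pi> j < \<pi> i)"
  proof (cases "1 \<le> i \<and> i + 1 < j \<and> j \<le> n")
    case True
    then show ?thesis using rev_compl_adjacent_less_iff[OF p, of i j] by auto
  qed auto
qed auto

lemma card_swap: "card {(i, j). Q i j} = card {(i, j). Q j i}"
proof -
  have "{(i, j). Q j i} = prod.swap ` {(i, j). Q i j}" by auto
  then show ?thesis by (simp add: card_image)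
qed

text \<open>Inversions go to inversions with their two ends exchanged. The comparison with the right
  neighbour of the smaller letter becomes one with the left neighbour of the larger letter, and a
  low intermediate letter becomes a high one.\<close>

lemma adi_rev_compl:
  assumes p: "\<pi> \<in> perms n" shows "adi n (rev_compl n \<pi>) = adi_star n \<pi>"
  unfolding adi_def adi_star_def Let_def
\<comment> \<open>Reflection reverses the order of two positions, so the components are swapped
  first.\<close>
proof (subst card_swap, rule card_reflect[of _ "n + 1" "n + 1"])
  fix i j :: nat assume "i \<le> n + 1" "j \<le> n + 1"
  let ?\<rho> = "rev_compl n \<pi>" and ?r = "\<lambda>i. n + 1 - i"
  show "(1 \<le> ?r j \<and> ?r j < ?r i \<and> ?r i \<le> n \<and> ?\<rho> (?r i) < ?\<rho> (?r j) \<and>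
      (?\<rho> (?r i) < (?\<rho>(n + 1 := 0)) (?r i + 1) \<or> (\<exists>l. ?r j < l \<and> l < ?r i \<and> ?\<rho> l < ?\<rho> (?r i)))) \<longleftrightarrow>
    (1 \<le> i \<and> i < j \<and> j \<le> n \<and> \<pi> j < \<pi> i \<and>
      ((\<pi>(0 := n + 1)) (i - 1) < \<pi> i \<or> (\<exists>l. i < l \<and> l < j \<and> \<pi> i < \<pi> l)))"
  proof (cases "1 \<le> i \<and> i < j \<and> j \<le> n")
    case True
    have r: "?\<rho> (?r i) < ?\<rho> (?r j) \<longleftrightarrow> \<pi> j < \<pi> i"
      using rev_compl_less_iff[OF p, of i j] True by simp
    \<comment> \<open>At \<open>i = 1\<close> the boundary values 0 and \<open>n + 1\<close> come
      into play and make both sides false.\<close>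
    have step: "?\<rho> (?r i) < (?\<rho>(n + 1 := 0)) (?r i + 1) \<longleftrightarrow> (\<pi>(0 := n + 1)) (i - 1) < \<pi> i"
    proof (cases "i = 1")
      case True
      then show ?thesis using perms_range[OF p, of 1] \<open>1 \<le> i \<and> i < j \<and> j \<le> n\<close> by simp
    next
      case False
      then have "?r i + 1 = ?r (i - 1)" "?r i + 1 \<noteq> n + 1" "i - 1 \<noteq> 0" using True by auto
      then show ?thesis
        using rev_compl_less_iff[OF p, of i "i - 1"] True by simp
    qed
    have ex: "(\<exists>l. ?r j < l \<and> l < ?r i \<and> ?\<rho> l < ?\<rho> (?r i)) \<longleftrightarrow> (\<exists>l. i < l \<and> l < j \<and> \<pi> i < \<pi> l)"
    proof
      assume "\<exists>l. ?r j < l \<and> l < ?r i \<and> ?\<rho> l < ?\<rho> (?r i)"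
      then obtain l where l: "?r j < l" "l < ?r i" "?\<rho> l < ?\<rho> (?r i)" by blast
      then have "l = ?r (?r l)" by simp
      then have "\<pi> i < \<pi> (?r l)"
        using rev_compl_less_iff[OF p, of "?r l" i] l True by simp
      moreover have "i < ?r l" "?r l < j" using l True by auto
      ultimately show "\<exists>l. i < l \<and> l < j \<and> \<pi> i < \<pi> l" by blast
    next
      assume "\<exists>l. i < l \<and> l < j \<and> \<pi> i < \<pi> l"
      then obtain l where l: "i < l" "l < j" "\<pi> i < \<pi> l" by blast
      then have "?\<rho> (?r l) < ?\<rho> (?r i)"
        using rev_compl_less_iff[OF p, of l i] True by simp
      moreover have "?r j < ?r l" "?r l < ?r i" using l True by auto
      ultimately show "\<exists>l. ?r j < l \<and> l < ?r i \<and> ?\<rho> l < ?\<rho> (?r i)" by blast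
    qed
    have "1 \<le> ?r j" "?r j < ?r i" "?r i \<le> n" using True by auto
    then show ?thesis unfolding r step ex using True by blast
  next
    case False
    then have "\<not> (1 \<le> ?r j \<and> ?r j < ?r i \<and> ?r i \<le> n)" by auto
    then show ?thesis using False by blast
  qed
qed auto

theorem theorem1p1:
  fixes t q :: "'a::field" and n :: nat
  shows "qt_catalan n t q = des_stat_gf n [2,3,1] pat_13_2 t q \<and>
         qt_catalan n t q = des_stat_gf n [2,3,1] adi_star t q \<and>
         qt_catalan n t q = des_stat_gf n [3,1,2] pat_2_13 t q \<and>
         qt_catalan n t q = des_stat_gf n [3,1,2] adi t q \<and>
         qt_catalan n t q = des_stat_gf n [2,1,3] pat_31_2 t q \<and>
         qt_catalan n t q = des_stat_gf n [1,3,2] pat_2_31 t q \<and>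
         qt_catalan n t q = des_stat_gf n [2,3,1] pat_31_2 t q \<and>
         qt_catalan n t q = des_stat_gf n [3,1,2] pat_2_31 t q \<and>
         qt_catalan n t q = des_stat_gf n [2,1,3] pat_13_2 t q \<and>
         qt_catalan n t q = des_stat_gf n [1,3,2] pat_2_13 t q"
proof -
  have perm: "\<pi> \<in> perms n" if "\<pi> \<in> avoiding n p" for \<pi> p
    using that by (simp add: avoiding_def)
  \<comment> \<open>The four generating functions give items 1 and 7 directly and, through
    complement, items 5 and 9. Item 2 equals item 1 termwise, and the rest are reverse-complement
    images.\<close>
  have 1: "qt_catalan n t q = des_stat_gf n [2,3,1] pat_13_2 t q"
    unfolding des_stat_gf_def by (rule qt_catalan_des_13_2)
  have 2: "qt_catalan n t q = des_stat_gf n [2,3,1] adi_star t q"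
    unfolding 1 des_stat_gf_def by (intro sum.cong refl) (simp only: adi_star_eq_pat_13_2)
  have 3: "qt_catalan n t q = des_stat_gf n [3,1,2] pat_2_13 t q"
    unfolding 1 des_stat_gf_def sum_avoiding_312
    by (intro sum.cong refl) (simp only: perm des_rev_compl pat_2_13_rev_compl)
  have 4: "qt_catalan n t q = des_stat_gf n [3,1,2] adi t q"
    unfolding 2 des_stat_gf_def sum_avoiding_312
    by (intro sum.cong refl) (simp only: perm des_rev_compl adi_rev_compl)
  have 5: "qt_catalan n t q = des_stat_gf n [2,1,3] pat_31_2 t q"
    unfolding qt_catalan_asc_13_2 des_stat_gf_def sum_avoiding_213
    by (intro sum.cong refl) (simp only: perm des_compl pat_31_2_compl)
  have 6: "qt_catalan n t q = des_stat_gf n [1,3,2] pat_2_31 t q"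
    unfolding 5 des_stat_gf_def sum_avoiding_132
    by (intro sum.cong refl) (simp only: perm des_rev_compl pat_2_31_rev_compl)
  have 7: "qt_catalan n t q = des_stat_gf n [2,3,1] pat_31_2 t q"
    unfolding des_stat_gf_def by (rule qt_catalan_des_31_2)
  have 8: "qt_catalan n t q = des_stat_gf n [3,1,2] pat_2_31 t q"
    unfolding 7 des_stat_gf_def sum_avoiding_312
    by (intro sum.cong refl) (simp only: perm des_rev_compl pat_2_31_rev_compl)
  have 9: "qt_catalan n t q = des_stat_gf n [2,1,3] pat_13_2 t q"
    unfolding qt_catalan_asc_31_2 des_stat_gf_def sum_avoiding_213
    by (intro sum.cong refl) (simp only: perm des_compl pat_13_2_compl)
  have 10: "qt_catalan n t q = des_stat_gf n [1,3,2] pat_2_13 t q"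
    unfolding 9 des_stat_gf_def sum_avoiding_132
    by (intro sum.cong refl) (simp only: perm des_rev_compl pat_2_13_rev_compl)
  show ?thesis using 1 2 3 4 5 6 7 8 9 10 by blast
qed

end
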